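(* Let $K$ be a field. The toric ideal $\mathcal{I}_{\nabla}$ of any $d$-dimensional flow polytope $\nabla$ has an initial ideal (with respect to some monomial order) generated by square-free monomials of degree at most $d$.
   Context: A lattice polytope in $\mathbb{R}^m$ is the convex hull of finitely many points of $\mathbb{R}^m$ whose vertices belong to $\mathbb{Z}^m$. Lattice polytopes $\nabla\subset\mathbb{R}^m$ and $\nabla'\subset\mathbb{R}^{m'}$ are equivalent if there is an affine linear isomorphism $\mathrm{AffSpan}(\nabla)\to\mathrm{AffSpan}(\nabla')$ (between the affine subspaces they generate) mapping $\mathrm{AffSpan}(\nabla)\cap\mathbb{Z}^m$ onto $\mathrm{AffSpan}(\nabla')\cap\mathbb{Z}^{m'}$ and $\nabla$ onto $\nabla'$. A quiver $Q$ is a finite directed graph with vertex set $Q_0$ and arrow set $Q_1$; multiple arrows are allowed, loops are not; $a^-$ and $a^+$ denote the tail and the head of $a\in Q_1$. For a weight $\theta\in\mathbb{Z}^{Q_0}$ put $\mathcal{A}(Q,\theta)=\{x\in\mathbb{R}^{Q_1}\mid \forall v\in Q_0:\ \sum_{a^+=v}x(a)-\sum_{a^-=v}x(a)=\theta(v)\}$, and for $\underline{\ell},\underline{u}\in\mathbb{N}_0^{Q_1}$ put $\nabla(Q,\theta,\underline{\ell},\underline{u})=\{x\in\mathcal{A}(Q,\theta)\mid \forall a\in Q_1:\ \underline{\ell}(a)\le x(a)\le\underline{u}(a)\}$ (a lattice polytope in $\mathbb{R}^{Q_1}$). A flow polytope is a lattice polytope equivalent to some $\nabla(Q,\theta,\underline{\ell},\underline{u})$;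 equivalently, to some $\nabla(Q,\theta)=\{x\in\mathcal{A}(Q,\theta)\mid \forall a\in Q_1:\ x(a)\ge0\}$ with $Q$ acyclic. For a lattice polytope $\nabla\subset\mathbb{R}^m$, the toric ideal $\mathcal{I}_{\nabla}$ is the ideal of the polynomial ring $K[t_z\mid z\in\nabla\cap\mathbb{Z}^m]$ generated by all binomials $\prod_z t_z^{\alpha(z)}-\prod_z t_z^{\beta(z)}$ with $\alpha,\beta\in\mathbb{N}_0^{\nabla\cap\mathbb{Z}^m}$, $\sum_z\alpha(z)z=\sum_z\beta(z)z$ and $\sum_z\alpha(z)=\sum_z\beta(z)$.
   Formalization: Dimension d = 1 is excluded: there the claim fails, since the segment [0,2] is a flow polytope with toric ideal (t_0 t_2 - t_1^2), whose initial ideals need a generator of degree 2; the only one-dimensional case lost where it holds is the unit segment, with zero ideal. *)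

theory Defs
  imports
    "HOL-Analysis.Analysis"
    "HOL-Algebra.Ideal"
    "HOL-Library.Poly_Mapping"
    "Graph_Theory.Digraph"
begin

section \<open>Lattice polytopes\<close>

definition int_points :: "(real ^ 'n) set" where
  "int_points = {x. \<forall>i. x $ i \<in> \<int>}"

definition lattice_polytope :: "(real ^ 'n) set \<Rightarrow> bool" where
  "lattice_polytope P \<longleftrightarrow> polytope P \<and> (\<forall>v. v extreme_point_of P \<longrightarrow> v \<in> int_points)"

definition affine_map_on :: "'a::real_vector set \<Rightarrow> ('a \<Rightarrow> 'b::real_vector) \<Rightarrow> bool" where
  "affine_map_on A f \<longleftrightarrow>
     (\<forall>x\<in>A. \<forall>y\<in>A. \<forall>t::real. f ((1 - t) *\<^sub>R x + t *\<^sub>R y) = (1 - t) *\<^sub>R f x + t *\<^sub>R f y)"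

definition lattice_equivalent :: "(real ^ 'm) set \<Rightarrow> (real ^ 'n) set \<Rightarrow> bool" where
  "lattice_equivalent P P' \<longleftrightarrow>
     (\<exists>f. affine_map_on (affine hull P) f \<and>
          bij_betw f (affine hull P) (affine hull P') \<and>
          f ` (affine hull P \<inter> int_points) = affine hull P' \<inter> int_points \<and>
          f ` P = P')"

section \<open>Flow polytopes\<close>

definition quiver :: "('v, 'e) pre_digraph \<Rightarrow> bool" where
  "quiver Q \<longleftrightarrow> fin_digraph Q \<and> loopfree_digraph Q"

(* The arrows of Q form a subset of the index type, and the space of real functions on the
   arrows is the coordinate subspace of all vectors vanishing outside this subset. *)
definition weight_space ::
  "('v, 'e::finite) pre_digraph \<Rightarrow> ('v \<Rightarrow> int) \<Rightarrow> (real ^ 'e) set" where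
  "weight_space Q \<theta> =
     {x. (\<forall>a. a \<notin> arcs Q \<longrightarrow> x $ a = 0) \<and>
         (\<forall>v\<in>verts Q. (\<Sum>a\<in>in_arcs Q v. x $ a) - (\<Sum>a\<in>out_arcs Q v. x $ a) = of_int (\<theta> v))}"

definition flow_region ::
  "('v, 'e::finite) pre_digraph \<Rightarrow> ('v \<Rightarrow> int) \<Rightarrow> ('e \<Rightarrow> nat) \<Rightarrow> ('e \<Rightarrow> nat) \<Rightarrow> (real ^ 'e) set" where
  "flow_region Q \<theta> l u =
     {x \<in> weight_space Q \<theta>. \<forall>a\<in>arcs Q. of_nat (l a) \<le> x $ a \<and> x $ a \<le> of_nat (u a)}"

(* A flow polytope is a lattice polytope satisfying this predicate for some quiver Q. The quiver
   is a parameter because its type of arrows cannot be quantified inside a formula. *)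
definition flow_polytope_of :: "('v, 'e::finite) pre_digraph \<Rightarrow> (real ^ 'm) set \<Rightarrow> bool" where
  "flow_polytope_of Q P \<longleftrightarrow>
     quiver Q \<and> lattice_polytope P \<and> (\<exists>\<theta> l u. lattice_equivalent P (flow_region Q \<theta> l u))"

section \<open>Polynomial rings, monomial orders and initial ideals\<close>

(* Monomials are identified with their exponent vectors, so the product of monomials is the
   sum of exponent vectors and the monomial 1 is 0. *)
type_synonym 'x mono = "'x \<Rightarrow>\<^sub>0 nat"
type_synonym ('x, 'k) mpoly = "'x mono \<Rightarrow>\<^sub>0 'k"

definition monomials :: "'x set \<Rightarrow> 'x mono set" where
  "monomials V = {m. Poly_Mapping.keys m \<subseteq> V}"

definition monomial_poly :: "'x mono \<Rightarrow> ('x, 'k::field) mpoly" where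
  "monomial_poly m = Poly_Mapping.single m 1"

(* The polynomial ring over the field 'k in the variables t_z for z in V. *)
definition mpoly_ring :: "'x set \<Rightarrow> ('x, 'k::field) mpoly ring" where
  "mpoly_ring V =
     \<lparr>carrier = {p. Poly_Mapping.keys p \<subseteq> monomials V}, mult = (*), one = 1, zero = 0, add = (+)\<rparr>"

definition monomial_order :: "'x set \<Rightarrow> 'x mono rel \<Rightarrow> bool" where
  "monomial_order V r \<longleftrightarrow>
     linear_order_on (monomials V) r \<and>
     (\<forall>m\<in>monomials V. (0, m) \<in> r) \<and>
     (\<forall>m n k. (m, n) \<in> r \<longrightarrow> k \<in> monomials V \<longrightarrow> (m + k, n + k) \<in> r)"

definition leading_monomial :: "'x mono rel \<Rightarrow> ('x, 'k::field) mpoly \<Rightarrow> 'x mono" where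
  "leading_monomial r p = (THE m. m \<in> Poly_Mapping.keys p \<and> (\<forall>n\<in>Poly_Mapping.keys p. (n, m) \<in> r))"

definition initial_ideal ::
  "'x set \<Rightarrow> 'x mono rel \<Rightarrow> ('x, 'k::field) mpoly set \<Rightarrow> ('x, 'k) mpoly set" where
  "initial_ideal V r I =
     genideal (mpoly_ring V) {monomial_poly (leading_monomial r p) |p. p \<in> I \<and> p \<noteq> 0}"

definition mono_degree :: "'x mono \<Rightarrow> nat" where
  "mono_degree m = (\<Sum>z\<in>Poly_Mapping.keys m. Poly_Mapping.lookup m z)"

definition squarefree_mono :: "'x mono \<Rightarrow> bool" where
  "squarefree_mono m \<longleftrightarrow> (\<forall>z. Poly_Mapping.lookup m z \<le> 1)"

section \<open>Toric ideals\<close>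

definition toric_ideal :: "(real ^ 'm) set \<Rightarrow> (real ^ 'm, 'k::field) mpoly set" where
  "toric_ideal P =
     (let V = P \<inter> int_points in
      genideal (mpoly_ring V)
        {monomial_poly \<alpha> - monomial_poly \<beta> |\<alpha> \<beta>.
           \<alpha> \<in> monomials V \<and> \<beta> \<in> monomials V \<and>
           (\<Sum>z\<in>V. of_nat (Poly_Mapping.lookup \<alpha> z) *\<^sub>R z) =
             (\<Sum>z\<in>V. of_nat (Poly_Mapping.lookup \<beta> z) *\<^sub>R z) \<and>
           (\<Sum>z\<in>V. Poly_Mapping.lookup \<alpha> z) = (\<Sum>z\<in>V. Poly_Mapping.lookup \<beta> z)})"

(* The degree bound d for a d-dimensional flow polytope fails for d = 1: the segment [0,2], the
   flow polytope of two vertices joined by two parallel arrows, has the toric ideal generated by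
   t_0 t_2 - t_1^2, all of whose initial ideals are generated in degree 2. Dimension 1 therefore
   has to be excluded. *)

end

theory Submission
  imports Defs "HOL-Library.List_Lexorder"
begin

text \<open>Let \<open>V\<close> be the set of lattice points of the polytope, and call two monomials equivalent (in the same
fibre) when their exponent vectors have the same total degree and the same weighted sum of lattice
points. The toric ideal is spanned by the differences of equivalent monomials, so for every monomial
order its initial ideal is spanned by the monomials that are not the smallest ones of their fibres
(\<open>initial_ideal_binomial_ideal\<close>). What remains is to choose an order for which the nonminimal
monomials without nonminimal proper divisors (\<open>minimal_generator\<close>) are square-free of degree at most
\<open>d\<close>.

The lattice points are read in flow coordinates \<open>c z a\<close>, the value of the flow on the arrow \<open>a\<close>. The
order compares first the degree, then the energy \<open>\<Sum>c z a\<^sup>2\<close> summed over all factors, and breaks ties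
reverse lexicographically. Energy is a strictly convex height function, so it cuts the polytope
along all hyperplanes on which some coordinate is an integer, into cells of the form of unit boxes
intersected with the polytope; the tie-break is a pulling triangulation of each cell. All that is
used of flows is that they decompose: an integral flow of weight \<open>D \<theta>\<close> that satisfies \<open>D\<close>-fold bounds
is a sum of \<open>D\<close> integral flows of weight \<open>\<theta>\<close> that satisfy the bounds (\<open>flow_decomposition\<close>).

Let \<open>m\<close> be a minimal generator. If two of its factors differ by at least 2 in some coordinate, then
the sum of these two flows also decomposes into two flows as close as possible to its half, which
lowers the energy; hence \<open>m\<close> is the product of these two factors, of degree 2.

Otherwise \<open>m\<close> lives in one unit box, and so does every smaller equivalent monomial \<open>n\<close>, because its
energy cannot be lower. By minimality \<open>m\<close> and \<open>n\<close> have no common factor, and the first variable \<open>z\<close>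
occurring in them divides \<open>n\<close>. The point \<open>z\<close> lies in every face of the box that contains the support
\<open>S\<close> of \<open>m\<close>, so the flow \<open>\<Sum>S - z\<close> decomposes within the box; the decomposition together with \<open>z\<close> is
smaller than the square-free monomial with support \<open>S\<close>, so \<open>m\<close> is this square-free monomial
(\<open>squarefree_part_nonminimal\<close>).

If \<open>S\<close> had more than \<open>d\<close> points, then \<open>S\<close> and \<open>z\<close> together would be affinely dependent. Splitting an
integral dependence into its positive and its negative part gives two equivalent monomials supported
in \<open>S\<close> and \<open>z\<close>, without common factors. The larger one does not contain \<open>z\<close>, hence is nonminimal with
support inside \<open>S\<close>, hence has support \<open>S\<close> by minimality of \<open>m\<close>. The other one is then a power of \<open>z\<close>,
and \<open>z\<close> is a convex combination of \<open>S\<close>. But \<open>z\<close> is a vertex of the unit box, which forces \<open>z \<in> S\<close>, a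
contradiction (\<open>minimal_generator_degree\<close>).\<close>

section \<open>Initial ideals of binomial ideals\<close>

lemma zero_in_monomials: "0 \<in> monomials V"
  by (simp add: monomials_def)

lemma add_in_monomials: "m \<in> monomials V \<Longrightarrow> n \<in> monomials V \<Longrightarrow> m + n \<in> monomials V"
  using keys_add[of m n] by (auto simp: monomials_def)

lemma keys_nat_add: "Poly_Mapping.keys (m + n :: 'x mono) = Poly_Mapping.keys m \<union> Poly_Mapping.keys n"
  by (auto simp: in_keys_iff lookup_add)

lemma ring_mpoly_ring: "ring (mpoly_ring V :: ('x, 'k::field) mpoly ring)"
proof -
  have add: "Poly_Mapping.keys (p + q) \<subseteq> monomials V"
    if "Poly_Mapping.keys p \<subseteq> monomials V" "Poly_Mapping.keys q \<subseteq> monomials V"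
    for p q :: "('x, 'k) mpoly"
    using keys_add[of p q] that by blast
  have mult: "Poly_Mapping.keys (p * q) \<subseteq> monomials V"
    if "Poly_Mapping.keys p \<subseteq> monomials V" "Poly_Mapping.keys q \<subseteq> monomials V"
    for p q :: "('x, 'k) mpoly"
    using keys_mult[of p q] that add_in_monomials by blast
  have neg: "Poly_Mapping.keys (- p) \<subseteq> monomials V" if "Poly_Mapping.keys p \<subseteq> monomials V"
    for p :: "('x, 'k) mpoly"
    using that by (auto simp: in_keys_iff subset_iff)
  show ?thesis
  proof (rule ringI)
    show "abelian_group (mpoly_ring V :: ('x, 'k) mpoly ring)"
    proof (rule abelian_groupI)
      fix p :: "('x, 'k) mpoly" assume "p \<in> carrier (mpoly_ring V)"
      then show "\<exists>q\<in>carrier (mpoly_ring V). q \<oplus>\<^bsub>mpoly_ring V\<^esub> p = \<zero>\<^bsub>mpoly_ring V\<^esub>"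
        using neg by (intro bexI[of _ "- p"]) (auto simp: mpoly_ring_def)
    qed (use add in \<open>auto simp: mpoly_ring_def add.assoc add.commute\<close>)
    show "monoid (mpoly_ring V :: ('x, 'k) mpoly ring)"
      by (rule monoidI)
        (use mult in \<open>auto simp: mpoly_ring_def mult.assoc zero_in_monomials\<close>)
  qed (auto simp: mpoly_ring_def distrib_left distrib_right)
qed

text \<open>The linear functional with prescribed values on the monomials. With \<open>h\<close> the indicator of a class of
monomials it adds up the coefficients over that class.\<close>

definition eval_sum :: "('x mono \<Rightarrow> 'k) \<Rightarrow> ('x, 'k::field) mpoly \<Rightarrow> 'k" where
  "eval_sum h p = (\<Sum>n\<in>Poly_Mapping.keys p. Poly_Mapping.lookup p n * h n)"

lemma eval_sum_superset:
  assumes "finite A" "Poly_Mapping.keys p \<subseteq> A"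
  shows "eval_sum h p = (\<Sum>n\<in>A. Poly_Mapping.lookup p n * h n)"
  unfolding eval_sum_def by (rule sum.mono_neutral_left) (use assms in \<open>auto simp: in_keys_iff\<close>)

lemma eval_sum_add: "eval_sum h (p + q) = eval_sum h p + eval_sum h q"
proof -
  let ?A = "Poly_Mapping.keys p \<union> Poly_Mapping.keys q"
  have "eval_sum h (p + q) = (\<Sum>n\<in>?A. Poly_Mapping.lookup (p + q) n * h n)"
    by (rule eval_sum_superset) (use keys_add[of p q] in auto)
  also have "\<dots> = (\<Sum>n\<in>?A. Poly_Mapping.lookup p n * h n) + (\<Sum>n\<in>?A. Poly_Mapping.lookup q n * h n)"
    by (simp add: lookup_add algebra_simps sum.distrib)
  finally show ?thesis
    by (simp add: eval_sum_superset[of ?A])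
qed

lemma eval_sum_zero [simp]: "eval_sum h 0 = 0"
  by (simp add: eval_sum_def)

lemma eval_sum_uminus: "eval_sum h (- p) = - eval_sum h p"
  using eval_sum_add[of h p "- p"] by (simp add: eq_neg_iff_add_eq_0 add.commute)

lemma eval_sum_single: "eval_sum h (Poly_Mapping.single n c) = c * h n"
  by (simp add: eval_sum_def)

lemma eval_sum_sum: "eval_sum h (sum f A) = (\<Sum>i\<in>A. eval_sum h (f i))"
  by (induction A rule: infinite_finite_induct) (auto simp: eval_sum_add)

lemma sum_of_terms:
  "p = (\<Sum>n\<in>Poly_Mapping.keys p. Poly_Mapping.single n (Poly_Mapping.lookup p n))"
proof (rule poly_mapping_eqI)
  fix k
  show "Poly_Mapping.lookup p k =
    Poly_Mapping.lookup (\<Sum>n\<in>Poly_Mapping.keys p. Poly_Mapping.single n (Poly_Mapping.lookup p n)) k"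
    by (simp add: lookup_sum lookup_single when_def in_keys_iff)
qed

lemma eval_sum_mult:
  "eval_sum h (p * q) =
     (\<Sum>k\<in>Poly_Mapping.keys q. Poly_Mapping.lookup q k * eval_sum (\<lambda>n. h (n + k)) p)"
proof -
  have "p * q = (\<Sum>n\<in>Poly_Mapping.keys p. \<Sum>k\<in>Poly_Mapping.keys q.
      Poly_Mapping.single (n + k) (Poly_Mapping.lookup p n * Poly_Mapping.lookup q k))"
    by (subst sum_of_terms[of p], subst sum_of_terms[of q]) (simp add: sum_product mult_single)
  then have "eval_sum h (p * q) = (\<Sum>n\<in>Poly_Mapping.keys p. \<Sum>k\<in>Poly_Mapping.keys q.
      Poly_Mapping.lookup p n * Poly_Mapping.lookup q k * h (n + k))"
    by (simp add: eval_sum_sum eval_sum_single)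
  also have "\<dots> = (\<Sum>k\<in>Poly_Mapping.keys q. \<Sum>n\<in>Poly_Mapping.keys p.
      Poly_Mapping.lookup p n * Poly_Mapping.lookup q k * h (n + k))"
    by (rule sum.swap)
  finally show ?thesis
    by (simp add: eval_sum_def sum_distrib_left mult_ac)
qed

lemma leading_monomial_eqI:
  assumes "monomial_order V r" "m \<in> Poly_Mapping.keys p"
    and "\<And>n. n \<in> Poly_Mapping.keys p \<Longrightarrow> (n, m) \<in> r"
  shows "leading_monomial r p = m"
  unfolding leading_monomial_def
proof (rule the_equality)
  have "antisym r"
    using assms(1) by (auto simp: monomial_order_def order_on_defs)
  then show "n = m" if "n \<in> Poly_Mapping.keys p \<and> (\<forall>k\<in>Poly_Mapping.keys p. (k, n) \<in> r)" for n
    using that assms(2,3) by (meson antisymD)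
qed (use assms in auto)

lemma finite_has_greatest:
  assumes "linear_order_on A r" "finite B" "B \<noteq> {}" "B \<subseteq> A"
  obtains m where "m \<in> B" "\<And>n. n \<in> B \<Longrightarrow> (n, m) \<in> r"
proof -
  have "trans r" "total_on A r" and refl: "\<And>a. a \<in> A \<Longrightarrow> (a, a) \<in> r"
    using assms(1) by (auto simp: order_on_defs refl_on_def)
  from assms(2,3,4) have "\<exists>m\<in>B. \<forall>n\<in>B. (n, m) \<in> r"
  proof (induction B rule: finite_ne_induct)
    case (singleton x)
    then show ?case using refl by auto
  next
    case (insert x F)
    then obtain m where m: "m \<in> F" "\<forall>n\<in>F. (n, m) \<in> r" by auto
    show ?case
    proof (cases "(x, m) \<in> r")
      case True
      then show ?thesis using m by auto
    next
      case False
      then have "(m, x) \<in> r"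
        using \<open>total_on A r\<close> m insert.prems insert.hyps by (auto simp: total_on_def)
      then show ?thesis using m \<open>trans r\<close> refl insert.prems by (auto dest: transD)
    qed
  qed
  then show ?thesis using that by auto
qed

text \<open>A functional that is constant on the classes of a congruence \<open>E\<close> kills the binomials, and the
common kernel of these functionals is an ideal because multiplying by a monomial maps classes into
classes. So the coefficients of a member of the ideal add up to zero over every class, and its
leading monomial cannot be alone in its class: it is not the smallest monomial there. Conversely a
monomial that is not the smallest one leads the difference with a smaller one.\<close>

lemma initial_ideal_binomial_ideal:
  fixes V :: "'x set" and E :: "'x mono \<Rightarrow> 'x mono \<Rightarrow> bool"
  assumes order: "monomial_order V r"
    and E: "equivp E" and E_add: "\<And>m n k. E m n \<Longrightarrow> E (m + k) (n + k)"
    and G: "G \<subseteq> monomials V"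
    and G_nonminimal: "\<And>g. g \<in> G \<Longrightarrow> \<exists>n\<in>monomials V. E g n \<and> n \<noteq> g \<and> (n, g) \<in> r"
    and G_divides: "\<And>m n. m \<in> monomials V \<Longrightarrow> n \<in> monomials V \<Longrightarrow> E m n \<Longrightarrow> n \<noteq> m \<Longrightarrow> (n, m) \<in> r
      \<Longrightarrow> \<exists>g\<in>G. \<exists>k\<in>monomials V. m = g + k"
  defines "I \<equiv> genideal (mpoly_ring V :: ('x, 'k::field) mpoly ring)
    {monomial_poly \<alpha> - monomial_poly \<beta> |\<alpha> \<beta>. \<alpha> \<in> monomials V \<and> \<beta> \<in> monomials V \<and> E \<alpha> \<beta>}"
  shows "initial_ideal V r I = genideal (mpoly_ring V) (monomial_poly ` G)"
proof -
  let ?R = "mpoly_ring V :: ('x, 'k) mpoly ring"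
  interpret ring ?R by (rule ring_mpoly_ring)
  let ?B = "{monomial_poly \<alpha> - monomial_poly \<beta> :: ('x, 'k) mpoly |\<alpha> \<beta>.
    \<alpha> \<in> monomials V \<and> \<beta> \<in> monomials V \<and> E \<alpha> \<beta>}"
  have refl: "E m m" and sym: "E m n \<Longrightarrow> E n m" for m n
    using E by (auto intro: equivp_reflp equivp_symp)
  have trans: "E m n \<Longrightarrow> E n k \<Longrightarrow> E m k" for m n k
    using E by (rule equivp_transp)
  have lin: "linear_order_on (monomials V) r"
    using order by (simp add: monomial_order_def)
  have carrier_iff: "p \<in> carrier ?R \<longleftrightarrow> Poly_Mapping.keys p \<subseteq> monomials V" for p
    by (simp add: mpoly_ring_def)
  have B_carrier: "?B \<subseteq> carrier ?R"
  proof
    fix p assume "p \<in> ?B"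
    then obtain \<alpha> \<beta> where "p = monomial_poly \<alpha> - monomial_poly \<beta>" "\<alpha> \<in> monomials V" "\<beta> \<in> monomials V"
      by blast
    then show "p \<in> carrier ?R"
      using keys_diff[of "monomial_poly \<alpha> :: ('x, 'k) mpoly" "monomial_poly \<beta>"]
      by (auto simp: carrier_iff monomial_poly_def)
  qed
  define J where "J = {p \<in> carrier ?R. \<forall>h. (\<forall>m n. E m n \<longrightarrow> h m = h n) \<longrightarrow> eval_sum h p = 0}"
  have J: "ideal J ?R"
  proof (rule idealI)
    show "ring ?R" by (rule ring_mpoly_ring)
    have "J \<subseteq> carrier ?R" "\<zero>\<^bsub>?R\<^esub> \<in> J"
      by (auto simp: J_def mpoly_ring_def)
    moreover have "p \<oplus>\<^bsub>?R\<^esub> q \<in> J" if "p \<in> J" "q \<in> J" for p q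
      using that add.m_closed[of p q] by (auto simp: J_def mpoly_ring_def eval_sum_add)
    moreover have "\<ominus>\<^bsub>?R\<^esub> p \<in> J" if "p \<in> J" for p
    proof -
      have p: "p \<in> carrier ?R" using that by (simp add: J_def)
      have "p \<oplus>\<^bsub>?R\<^esub> (\<ominus>\<^bsub>?R\<^esub> p) = \<zero>\<^bsub>?R\<^esub>"
        using p by (rule r_neg)
      then have "\<ominus>\<^bsub>?R\<^esub> p = - p"
        by (simp add: mpoly_ring_def eq_neg_iff_add_eq_0 add.commute)
      then show ?thesis
        using that a_inv_closed[OF p] by (simp add: J_def eval_sum_uminus)
    qed
    ultimately show "subgroup J (add_monoid ?R)"
      by (intro subgroup.intro) (auto simp: a_inv_def)
    have comm: "p \<otimes>\<^bsub>?R\<^esub> q = q \<otimes>\<^bsub>?R\<^esub> p" for p q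
      by (simp add: mpoly_ring_def mult.commute)
    show right: "p \<otimes>\<^bsub>?R\<^esub> q \<in> J" if p: "p \<in> J" and q: "q \<in> carrier ?R" for p q
    proof -
      have "eval_sum h (p * q) = 0" if h: "\<forall>m n. E m n \<longrightarrow> h m = h n" for h
      proof -
        have "eval_sum (\<lambda>n. h (n + k)) p = 0" for k
          using p h E_add by (simp add: J_def)
        then show ?thesis by (simp add: eval_sum_mult)
      qed
      moreover have "p \<otimes>\<^bsub>?R\<^esub> q \<in> carrier ?R"
        using p q by (intro m_closed) (auto simp: J_def)
      ultimately show ?thesis by (simp add: J_def mpoly_ring_def)
    qed
    show "q \<otimes>\<^bsub>?R\<^esub> p \<in> J" if "p \<in> J" "q \<in> carrier ?R" for p q
      using right[OF that] by (simp add: comm)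
  qed
  have "?B \<subseteq> J"
  proof
    fix p assume p: "p \<in> ?B"
    then obtain \<alpha> \<beta> where *: "p = monomial_poly \<alpha> - monomial_poly \<beta>" "E \<alpha> \<beta>"
      by blast
    have "eval_sum h p = 0" if "\<forall>m n. E m n \<longrightarrow> h m = h n" for h
    proof -
      have "eval_sum h p = h \<alpha> - h \<beta>"
        using eval_sum_add[of h "monomial_poly \<alpha>" "- monomial_poly \<beta>"] *(1)
        by (simp add: eval_sum_uminus) (simp add: monomial_poly_def eval_sum_single)
      then show ?thesis using that *(2) by simp
    qed
    then show "p \<in> J" using p B_carrier by (auto simp: J_def)
  qed
  then have IJ: "I \<subseteq> J"
    unfolding I_def by (rule genideal_minimal[OF J])
  have G_carrier: "monomial_poly ` G \<subseteq> carrier ?R"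
    using G by (auto simp: carrier_iff monomial_poly_def)
  have leading: "monomial_poly (leading_monomial r p) \<in> Idl\<^bsub>?R\<^esub> (monomial_poly ` G)"
    if p: "p \<in> I" "p \<noteq> 0" for p
  proof -
    have keys: "Poly_Mapping.keys p \<subseteq> monomials V"
      using p IJ by (auto simp: J_def carrier_iff)
    obtain m where m: "m \<in> Poly_Mapping.keys p" "\<And>n. n \<in> Poly_Mapping.keys p \<Longrightarrow> (n, m) \<in> r"
      using finite_has_greatest[OF lin, of "Poly_Mapping.keys p"] keys p by auto
    have lm: "leading_monomial r p = m"
      using leading_monomial_eqI[OF order] m by blast
    \<comment> \<open>The coefficients over the class of the leading monomial add up to zero, so that class
      contributes a second, smaller monomial.\<close>
    let ?h = "\<lambda>n. if E m n then 1 else 0 :: 'k"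
    have "E a b \<Longrightarrow> E m a = E m b" for a b
      using sym trans by blast
    then have "eval_sum ?h p = 0"
      using p IJ unfolding J_def by (smt (verit, best) mem_Collect_eq subsetD)
    then have *: "(\<Sum>n\<in>Poly_Mapping.keys p. Poly_Mapping.lookup p n * ?h n) = 0"
      by (simp add: eval_sum_def)
    have "\<exists>n\<in>Poly_Mapping.keys p. E m n \<and> n \<noteq> m"
    proof (rule ccontr)
      assume "\<not> ?thesis"
      then have "(\<Sum>n\<in>Poly_Mapping.keys p - {m}. Poly_Mapping.lookup p n * ?h n) = 0"
        by (intro sum.neutral) auto
      then have "Poly_Mapping.lookup p m * ?h m = 0"
        using * by (subst (asm) sum.remove[OF _ m(1)]) auto
      then show False using m(1) refl by (simp add: in_keys_iff)
    qed
    then obtain n where n: "n \<in> Poly_Mapping.keys p" "E m n" "n \<noteq> m" by blast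
    then obtain g k where gk: "g \<in> G" "k \<in> monomials V" "m = g + k"
      using G_divides[of m n] m keys by blast
    interpret ideal "Idl\<^bsub>?R\<^esub> (monomial_poly ` G)" ?R
      by (rule genideal_ideal[OF G_carrier])
    have "monomial_poly g \<otimes>\<^bsub>?R\<^esub> monomial_poly k \<in> Idl\<^bsub>?R\<^esub> (monomial_poly ` G)"
      by (rule I_r_closed)
        (use gk genideal_self[OF G_carrier] in \<open>auto simp: carrier_iff monomial_poly_def\<close>)
    then show ?thesis
      by (simp add: lm gk mpoly_ring_def monomial_poly_def mult_single)
  qed
  let ?L = "{monomial_poly (leading_monomial r p) |p. p \<in> I \<and> p \<noteq> 0} :: ('x, 'k) mpoly set"
  have L_sub: "?L \<subseteq> Idl\<^bsub>?R\<^esub> (monomial_poly ` G)" using leading by blast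
  have idG: "ideal (Idl\<^bsub>?R\<^esub> (monomial_poly ` G)) ?R" by (rule genideal_ideal[OF G_carrier])
  have L_carrier: "?L \<subseteq> carrier ?R"
    using L_sub ideal.Icarr[OF idG] by blast
  have "monomial_poly ` G \<subseteq> ?L"
  proof
    fix q :: "('x, 'k) mpoly" assume "q \<in> monomial_poly ` G"
    then obtain g where g: "g \<in> G" "q = monomial_poly g" by blast
    then obtain n where n: "n \<in> monomials V" "E g n" "n \<noteq> g" "(n, g) \<in> r"
      using G_nonminimal by blast
    let ?p = "monomial_poly g - monomial_poly n :: ('x, 'k) mpoly"
    have "?p \<in> ?B" using g n G by blast
    then have "?p \<in> I" using genideal_self[OF B_carrier] by (auto simp: I_def)
    moreover have "Poly_Mapping.keys ?p = {g, n}"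
      using n by (auto simp: in_keys_iff lookup_minus monomial_poly_def lookup_single when_def
        split: if_splits)
    moreover have "(g, g) \<in> r"
      using lin g G by (auto simp: order_on_defs refl_on_def)
    ultimately have "?p \<in> I" "leading_monomial r ?p = g" "?p \<noteq> 0"
      using n by (auto intro!: leading_monomial_eqI[OF order])
    then show "q \<in> ?L"
      unfolding g(2) by (intro CollectI exI[of _ ?p]) simp
  qed
  then have "monomial_poly ` G \<subseteq> Idl\<^bsub>?R\<^esub> ?L"
    using genideal_self[OF L_carrier] by blast
  then show ?thesis
    unfolding initial_ideal_def
    using genideal_minimal[OF idG L_sub] genideal_minimal[OF genideal_ideal[OF L_carrier]]
    by blast
qed

section \<open>Weighted degrees of monomials\<close>

definition wdeg :: "'x set \<Rightarrow> ('x \<Rightarrow> int) \<Rightarrow> 'x mono \<Rightarrow> int" where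
  "wdeg V w m = (\<Sum>z\<in>V. int (Poly_Mapping.lookup m z) * w z)"

lemma wdeg_add: "wdeg V w (m + n) = wdeg V w m + wdeg V w n"
  by (simp add: wdeg_def lookup_add algebra_simps sum.distrib)

lemma wdeg_zero [simp]: "wdeg V w 0 = 0"
  by (simp add: wdeg_def)

lemma wdeg_single:
  assumes "finite V" "z \<in> V"
  shows "wdeg V w (Poly_Mapping.single z k) = int k * w z"
proof -
  have "wdeg V w (Poly_Mapping.single z k) = (\<Sum>y\<in>V. if y = z then int k * w z else 0)"
    unfolding wdeg_def by (rule sum.cong) (auto simp: lookup_single when_def)
  then show ?thesis using assms by simp
qed

lemma wdeg_plus_weight: "wdeg V (\<lambda>z. v z + w z) m = wdeg V v m + wdeg V w m"
  by (simp add: wdeg_def algebra_simps sum.distrib)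

lemma wdeg_scale_weight: "wdeg V (\<lambda>z. k * w z) m = k * wdeg V w m"
  by (simp add: wdeg_def sum_distrib_left mult_ac)

lemma wdeg_sum_weight: "wdeg V (\<lambda>z. \<Sum>i\<in>A. w i z) m = (\<Sum>i\<in>A. wdeg V (w i) m)"
  unfolding wdeg_def by (simp add: sum_distrib_left) (rule sum.swap)

lemma wdeg_cong: "(\<And>z. z \<in> V \<Longrightarrow> w z = w' z) \<Longrightarrow> wdeg V w m = wdeg V w' m"
  by (simp add: wdeg_def)

lemma wdeg_nonneg: "(\<And>z. z \<in> V \<Longrightarrow> 0 \<le> w z) \<Longrightarrow> 0 \<le> wdeg V w m"
  unfolding wdeg_def by (rule sum_nonneg) simp

lemma wdeg_eq_0_iff:
  assumes "finite V" "m \<in> monomials V" "\<And>z. z \<in> V \<Longrightarrow> 0 \<le> w z"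
  shows "wdeg V w m = 0 \<longleftrightarrow> (\<forall>z\<in>Poly_Mapping.keys m. w z = 0)"
proof -
  have "wdeg V w m = 0 \<longleftrightarrow> (\<forall>z\<in>V. int (Poly_Mapping.lookup m z) * w z = 0)"
    unfolding wdeg_def using assms by (intro sum_nonneg_eq_0_iff) auto
  also have "\<dots> \<longleftrightarrow> (\<forall>z\<in>Poly_Mapping.keys m. w z = 0)"
    using assms(2) by (auto simp: monomials_def in_keys_iff)
  finally show ?thesis .
qed

lemma wdeg_degree:
  assumes "finite V" "m \<in> monomials V"
  shows "wdeg V (\<lambda>_. 1) m = int (mono_degree m)"
proof -
  have "mono_degree m = (\<Sum>z\<in>V. Poly_Mapping.lookup m z)"
    unfolding mono_degree_def
    by (rule sum.mono_neutral_left) (use assms in \<open>auto simp: monomials_def in_keys_iff\<close>)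
  then show ?thesis by (simp add: wdeg_def)
qed

definition squarefree_of :: "'x set \<Rightarrow> 'x mono" where
  "squarefree_of S = (\<Sum>z\<in>S. Poly_Mapping.single z 1)"

lemma lookup_squarefree_of:
  "finite S \<Longrightarrow> Poly_Mapping.lookup (squarefree_of S) z = (if z \<in> S then 1 else 0)"
  by (simp add: squarefree_of_def lookup_sum lookup_single when_def)

lemma keys_squarefree_of: "finite S \<Longrightarrow> Poly_Mapping.keys (squarefree_of S) = S"
  by (auto simp: in_keys_iff lookup_squarefree_of split: if_splits)

lemma wdeg_squarefree_of:
  assumes "finite V" "S \<subseteq> V"
  shows "wdeg V w (squarefree_of S) = (\<Sum>z\<in>S. w z)"
proof -
  have "finite S" using assms finite_subset by blast
  then have "wdeg V w (squarefree_of S) = (\<Sum>z\<in>V. if z \<in> S then w z else 0)"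
    unfolding wdeg_def by (intro sum.cong) (auto simp: lookup_squarefree_of)
  also have "\<dots> = (\<Sum>z\<in>S. w z)"
    using assms by (simp add: sum.inter_restrict[symmetric] Int_absorb1)
  finally show ?thesis .
qed

lemma divisor_eqI:
  fixes g m :: "'x mono"
  assumes "\<And>z. Poly_Mapping.lookup g z \<le> Poly_Mapping.lookup m z"
  obtains k where "m = g + k" "Poly_Mapping.keys k \<subseteq> Poly_Mapping.keys m"
proof
  show "m = g + (m - g)"
    by (rule poly_mapping_eqI) (simp add: lookup_add lookup_minus assms)
  show "Poly_Mapping.keys (m - g) \<subseteq> Poly_Mapping.keys m"
    by (auto simp: in_keys_iff lookup_minus)
qed

text \<open>Monomials are compared through integer lists that depend additively on the exponent vector; this
is why the resulting order is compatible with multiplication.\<close>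

lemma map2_add_less_cancel:
  fixes xs ys zs :: "int list"
  assumes "length xs = length ys" "length ys = length zs"
  shows "map2 (+) xs zs < map2 (+) ys zs \<longleftrightarrow> xs < ys"
  using assms by (induction xs ys zs rule: list_induct3) auto

text \<open>The comparison of reverse lexicographic type: a prefix in which nothing increases and something
decreases decides.\<close>

lemma map_less_map:
  fixes f g :: "'a \<Rightarrow> int"
  assumes "x \<in> set us" "f x < g x" "\<And>y. y \<in> set us \<Longrightarrow> f y \<le> g y"
  shows "map f (us @ vs) < map g (us @ vs)"
  using assms
proof (induction us)
  case (Cons u us)
  then have "f u \<le> g u" "x \<in> set us \<or> f u < g u" by auto
  then show ?case using Cons by (cases "f u < g u") (auto simp: order_le_less)
qed simp

section \<open>The energy order on the monomials of a lattice configuration\<close>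

text \<open>Finitely many points, given by an integral coordinate vector for each. For a flow polytope the
coordinates are the values of the flow on the arrows.\<close>

locale lattice_configuration =
  fixes V :: "'x set" and c :: "'x \<Rightarrow> 'e::finite \<Rightarrow> int"
  assumes finite_V: "finite V"
    and inj_c: "inj_on c V"
begin

definition same_fibre :: "'x mono \<Rightarrow> 'x mono \<Rightarrow> bool" where
  "same_fibre m n \<longleftrightarrow> wdeg V (\<lambda>_. 1) m = wdeg V (\<lambda>_. 1) n \<and>
     (\<forall>a. wdeg V (\<lambda>z. c z a) m = wdeg V (\<lambda>z. c z a) n)"

definition energy :: "'x mono \<Rightarrow> int" where
  "energy = wdeg V (\<lambda>z. \<Sum>a\<in>UNIV. (c z a)\<^sup>2)"

definition variables :: "'x list" where
  "variables = (SOME zs. set zs = V)"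

text \<open>The exponents enter negated: among monomials of equal degree and energy the one with the larger
exponent at the first difference is the smaller one. Comparing degrees first makes 1 the smallest
monomial although the later entries may be negative.\<close>

definition order_vector :: "'x mono \<Rightarrow> int list" where
  "order_vector m = wdeg V (\<lambda>_. 1) m # energy m #
     map (\<lambda>z. - int (Poly_Mapping.lookup m z)) variables"

definition term_order :: "'x mono rel" where
  "term_order = {(m, n). m \<in> monomials V \<and> n \<in> monomials V \<and> order_vector m \<le> order_vector n}"

definition nonminimal :: "'x mono \<Rightarrow> bool" where
  "nonminimal m \<longleftrightarrow> m \<in> monomials V \<and>
     (\<exists>n\<in>monomials V. same_fibre m n \<and> order_vector n < order_vector m)"

lemma set_variables: "set variables = V"
  unfolding variables_def using finite_list[OF finite_V] by (rule someI_ex)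

lemma order_vector_add: "order_vector (m + k) = map2 (+) (order_vector m) (order_vector k)"
  by (simp add: order_vector_def energy_def wdeg_add lookup_add zip_map_map zip_same_conv_map)

lemma order_vector_add_less:
  "order_vector (m + k) < order_vector (n + k) \<longleftrightarrow> order_vector m < order_vector n"
  unfolding order_vector_add by (rule map2_add_less_cancel) (simp_all add: order_vector_def)

lemma order_vector_inj:
  assumes "m \<in> monomials V" "n \<in> monomials V" "order_vector m = order_vector n"
  shows "m = n"
proof (rule poly_mapping_eqI)
  fix z show "Poly_Mapping.lookup m z = Poly_Mapping.lookup n z"
  proof (cases "z \<in> V")
    case True
    then show ?thesis
      using assms(3) by (simp add: order_vector_def set_variables)
  next
    case False
    then have "z \<notin> Poly_Mapping.keys m" "z \<notin> Poly_Mapping.keys n"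
      using assms by (auto simp: monomials_def)
    then show ?thesis by (simp add: in_keys_iff)
  qed
qed

lemma monomial_order_term_order: "monomial_order V term_order"
  unfolding monomial_order_def
proof (intro conjI ballI allI impI)
  show "linear_order_on (monomials V) term_order"
    unfolding order_on_defs
    by (auto simp: term_order_def refl_on_def trans_def antisym_def total_on_def intro: order_vector_inj)
  show "(0, m) \<in> term_order" if m: "m \<in> monomials V" for m
  proof (cases "m = 0")
    case False
    then have "wdeg V (\<lambda>_. 1) m \<noteq> 0"
      using m by (simp add: wdeg_eq_0_iff finite_V)
    moreover have "wdeg V (\<lambda>_. 1) m \<ge> 0" by (rule wdeg_nonneg) simp
    ultimately have "order_vector 0 < order_vector m"
      by (simp add: order_vector_def)
    then show ?thesis using m by (simp add: term_order_def zero_in_monomials)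
  qed (auto simp: term_order_def zero_in_monomials)
  show "(m + k, n + k) \<in> term_order" if "(m, n) \<in> term_order" "k \<in> monomials V" for m n k
    using that order_vector_add_less[of n k m] by (auto simp: term_order_def add_in_monomials not_less[symmetric])
qed

lemma order_vector_revlex:
  assumes "variables = xs @ z # ys" "z \<in> Poly_Mapping.keys n"
    and "Poly_Mapping.keys m \<inter> set (xs @ [z]) = {}"
    and "wdeg V (\<lambda>_. 1) m = wdeg V (\<lambda>_. 1) n" "energy m = energy n"
  shows "order_vector n < order_vector m"
proof -
  have "variables = (xs @ [z]) @ ys" using assms(1) by simp
  moreover have "Poly_Mapping.lookup m y = 0" if "y \<in> set (xs @ [z])" for y
    using that assms(3) by (metis IntI emptyE in_keys_iff)
  moreover have "Poly_Mapping.lookup n z > 0" using assms(2) by (simp add: in_keys_iff)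
  ultimately have "map (\<lambda>z. - int (Poly_Mapping.lookup n z)) variables
      < map (\<lambda>z. - int (Poly_Mapping.lookup m z)) variables"
    by (simp only:) (rule map_less_map[of z], auto)
  then show ?thesis using assms(4,5) by (simp add: order_vector_def)
qed

lemma same_fibre_add_cancel: "same_fibre (m + k) (n + k) \<Longrightarrow> same_fibre m n"
  by (simp add: same_fibre_def wdeg_add)

lemma same_fibre_wdeg_shift:
  assumes "same_fibre m n"
  shows "wdeg V (\<lambda>z. c z a - k) m = wdeg V (\<lambda>z. c z a - k) n"
proof -
  have "wdeg V (\<lambda>z. c z a - k) p = wdeg V (\<lambda>z. c z a) p + (- k) * wdeg V (\<lambda>_. 1) p" for p
    unfolding wdeg_scale_weight[symmetric] wdeg_plus_weight[symmetric] by simp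
  then show ?thesis using assms by (simp add: same_fibre_def)
qed

definition in_unit_box :: "('e \<Rightarrow> int) \<Rightarrow> 'x mono \<Rightarrow> bool" where
  "in_unit_box k m \<longleftrightarrow> (\<forall>z\<in>Poly_Mapping.keys m. \<forall>a. c z a = k a \<or> c z a = k a + 1)"

text \<open>The function \<open>t \<mapsto> (t - k) (t - k - 1)\<close> differs from \<open>t \<mapsto> t\<^sup>2\<close> by an affine function, is nonnegative on
the integers and vanishes there exactly at \<open>k\<close> and \<open>k + 1\<close>. So on a fibre, where affine functions have
constant sums, the excess is the energy up to a constant, and it measures the failure to lie in the
unit box at \<open>k\<close>.\<close>

definition excess :: "('e \<Rightarrow> int) \<Rightarrow> 'x mono \<Rightarrow> int" where
  "excess k = wdeg V (\<lambda>z. \<Sum>a\<in>UNIV. (c z a - k a) * (c z a - k a - 1))"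

lemma consecutive_product_nonneg: "0 \<le> (t - k) * (t - k - 1)" for t k :: int
  by (cases "t \<le> k") (auto intro: mult_nonneg_nonneg mult_nonpos_nonpos)

lemma excess_nonneg: "0 \<le> excess k m"
  unfolding excess_def by (intro wdeg_nonneg sum_nonneg consecutive_product_nonneg)

lemma excess_eq_0_iff:
  assumes "m \<in> monomials V"
  shows "excess k m = 0 \<longleftrightarrow> in_unit_box k m"
proof -
  have "excess k m = 0 \<longleftrightarrow>
    (\<forall>z\<in>Poly_Mapping.keys m. (\<Sum>a\<in>UNIV. (c z a - k a) * (c z a - k a - 1)) = 0)"
    unfolding excess_def using finite_V assms
    by (intro wdeg_eq_0_iff sum_nonneg consecutive_product_nonneg)
  also have "\<dots> \<longleftrightarrow> in_unit_box k m"
  proof -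
    have "(\<Sum>a\<in>UNIV. (c z a - k a) * (c z a - k a - 1)) = 0 \<longleftrightarrow> (\<forall>a. c z a = k a \<or> c z a = k a + 1)" for z
    proof -
      have "(\<Sum>a\<in>UNIV. (c z a - k a) * (c z a - k a - 1)) = 0 \<longleftrightarrow>
          (\<forall>a\<in>UNIV. (c z a - k a) * (c z a - k a - 1) = 0)"
        by (rule sum_nonneg_eq_0_iff) (auto intro: consecutive_product_nonneg)
      moreover have "(c z a - k a) * (c z a - k a - 1) = 0 \<longleftrightarrow> c z a = k a \<or> c z a = k a + 1" for a
        unfolding mult_eq_0_iff by linarith
      ultimately show ?thesis by simp
    qed
    then show ?thesis by (simp add: in_unit_box_def)
  qed
  finally show ?thesis .
qed

lemma excess_eq:
  "excess k m = energy m - (\<Sum>a\<in>UNIV. (2 * k a + 1) * wdeg V (\<lambda>z. c z a) m)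
     + (\<Sum>a\<in>UNIV. k a * (k a + 1)) * wdeg V (\<lambda>_. 1) m"
proof -
  have "excess k m = wdeg V (\<lambda>z. (\<Sum>a\<in>UNIV. (c z a)\<^sup>2)
      + ((\<Sum>a\<in>UNIV. (- (2 * k a + 1)) * c z a) + (\<Sum>a\<in>UNIV. k a * (k a + 1)) * 1)) m"
    unfolding excess_def
    by (rule wdeg_cong) (simp add: sum.distrib[symmetric], intro sum.cong,
        auto simp: algebra_simps power2_eq_square)
  also have "\<dots> = energy m + ((\<Sum>a\<in>UNIV. (- (2 * k a + 1)) * wdeg V (\<lambda>z. c z a) m)
      + (\<Sum>a\<in>UNIV. k a * (k a + 1)) * wdeg V (\<lambda>_. 1) m)"
    by (simp only: wdeg_plus_weight wdeg_sum_weight wdeg_scale_weight energy_def)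
  also have "(\<Sum>a\<in>UNIV. (- (2 * k a + 1)) * wdeg V (\<lambda>z. c z a) m)
      = - (\<Sum>a\<in>UNIV. (2 * k a + 1) * wdeg V (\<lambda>z. c z a) m)"
    by (simp only: mult_minus_left sum_negf)
  finally show ?thesis by simp
qed

lemma excess_diff_eq_energy_diff:
  "same_fibre m n \<Longrightarrow> excess k m - excess k n = energy m - energy n"
  by (simp add: excess_eq same_fibre_def)

lemma energy_eq_in_unit_box:
  assumes "same_fibre m n" "in_unit_box k m" "in_unit_box k n" "m \<in> monomials V" "n \<in> monomials V"
  shows "energy m = energy n"
  using excess_diff_eq_energy_diff[OF assms(1), of k] assms by (simp add: excess_eq_0_iff[symmetric])

text \<open>Monomials in a unit box have the least energy of their fibre, so anything smaller in the order has
the same energy and lies in the same box.\<close>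

lemma in_unit_box_smaller:
  assumes "same_fibre m n" "order_vector n < order_vector m" "in_unit_box k m"
    "m \<in> monomials V" "n \<in> monomials V"
  shows "in_unit_box k n"
proof -
  have "energy n \<le> energy m"
    using assms(1,2) by (auto simp: order_vector_def same_fibre_def split: if_splits)
  then have "excess k n \<le> excess k m"
    using excess_diff_eq_energy_diff[OF assms(1), of k] by simp
  then show ?thesis
    using assms excess_nonneg[of k n] by (simp add: excess_eq_0_iff[symmetric])
qed

definition minimal_generator :: "'x mono \<Rightarrow> bool" where
  "minimal_generator m \<longleftrightarrow> nonminimal m \<and> (\<forall>g k. m = g + k \<longrightarrow> nonminimal g \<longrightarrow> k = 0)"

lemma minimal_generator_divides:
  assumes "nonminimal m"
  obtains g k where "minimal_generator g" "k \<in> monomials V" "m = g + k"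
  using assms
proof (induction "nat (wdeg V (\<lambda>_. 1) m)" arbitrary: m thesis rule: less_induct)
  case less
  show ?case
  proof (cases "minimal_generator m")
    case True
    then show ?thesis using less.prems(1)[of m 0] by (simp add: zero_in_monomials)
  next
    case False
    then obtain g k where gk: "m = g + k" "nonminimal g" "k \<noteq> 0"
      using less.prems(2) by (auto simp: minimal_generator_def)
    have mV: "m \<in> monomials V" using less.prems(2) by (simp add: nonminimal_def)
    then have kV: "k \<in> monomials V" by (auto simp: gk monomials_def keys_nat_add)
    have "0 \<le> wdeg V (\<lambda>_. 1) g" "0 \<le> wdeg V (\<lambda>_. 1) k" by (auto intro: wdeg_nonneg)
    moreover have "wdeg V (\<lambda>_. 1) k \<noteq> 0"
      using gk kV by (simp add: wdeg_eq_0_iff finite_V)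
    ultimately have "nat (wdeg V (\<lambda>_. 1) g) < nat (wdeg V (\<lambda>_. 1) m)"
      by (simp add: gk wdeg_add)
    then obtain g' k' where "minimal_generator g'" "k' \<in> monomials V" "g = g' + k'"
      using less.hyps gk(2) by blast
    then show ?thesis
      using less.prems(1)[of g' "k' + k"] gk kV by (simp add: add.assoc add_in_monomials)
  qed
qed

text \<open>A common factor could be cancelled from both monomials without changing which one is smaller.\<close>

lemma minimal_generator_disjoint:
  assumes "minimal_generator m" "n \<in> monomials V" "same_fibre m n"
    "order_vector n < order_vector m"
  shows "Poly_Mapping.keys m \<inter> Poly_Mapping.keys n = {}"
proof (rule ccontr)
  assume "\<not> ?thesis"
  then obtain z where z: "z \<in> Poly_Mapping.keys m" "z \<in> Poly_Mapping.keys n" by blast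
  let ?t = "Poly_Mapping.single z (1::nat)"
  obtain m' where m': "m = ?t + m'" "Poly_Mapping.keys m' \<subseteq> Poly_Mapping.keys m"
    by (rule divisor_eqI[of ?t m]) (use z in \<open>auto simp: lookup_single when_def in_keys_iff\<close>)
  obtain n' where n': "n = ?t + n'" "Poly_Mapping.keys n' \<subseteq> Poly_Mapping.keys n"
    by (rule divisor_eqI[of ?t n]) (use z in \<open>auto simp: lookup_single when_def in_keys_iff\<close>)
  have "nonminimal m'"
    using assms m' n' same_fibre_add_cancel[of m' ?t n'] order_vector_add_less[of n' ?t m']
    unfolding nonminimal_def minimal_generator_def monomials_def
    by (auto simp: add.commute intro!: bexI[of _ n'])
  moreover have "m = m' + ?t" using m' by (simp add: add.commute)
  ultimately have "?t = 0" using assms(1) unfolding minimal_generator_def by blast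
  then show False by (metis lookup_single_eq lookup_zero zero_neq_one)
qed

end

section \<open>Generators of bounded degree\<close>

text \<open>The two properties of flow polytopes on which the degree bound rests. The first one is the integer
decomposition property, not only for the polytope but for its intersection with every box: the
point to be decomposed is an integral affine combination of \<open>V\<close>, and the requirements on \<open>lo\<close> and \<open>hi\<close>
keep the box inside the bounds of the polytope. The second one says that \<open>V\<close> has dimension at most
\<open>d\<close>: any \<open>d + 2\<close> points satisfy an integral affine dependence, here split by signs into two monomials.\<close>

locale box_decomposable = lattice_configuration V c
  for V :: "'x set" and c :: "'x \<Rightarrow> 'e::finite \<Rightarrow> int" +
  fixes d :: nat
  assumes decompose:
    "\<And>\<alpha> D lo hi. (\<Sum>z\<in>V. \<alpha> z) = int D \<Longrightarrow>
      (\<And>a. \<exists>p\<in>V. c p a \<le> lo a) \<Longrightarrow> (\<And>a. \<exists>q\<in>V. hi a \<le> c q a) \<Longrightarrow>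
      (\<And>a. int D * lo a \<le> (\<Sum>z\<in>V. \<alpha> z * c z a)) \<Longrightarrow>
      (\<And>a. (\<Sum>z\<in>V. \<alpha> z * c z a) \<le> int D * hi a) \<Longrightarrow>
      \<exists>\<beta>\<in>monomials V. wdeg V (\<lambda>_. 1) \<beta> = int D \<and>
        (\<forall>a. wdeg V (\<lambda>z. c z a) \<beta> = (\<Sum>z\<in>V. \<alpha> z * c z a)) \<and>
        (\<forall>z\<in>Poly_Mapping.keys \<beta>. \<forall>a. lo a \<le> c z a \<and> c z a \<le> hi a)"
    and dependent:
    "\<And>T. T \<subseteq> V \<Longrightarrow> d + 2 \<le> card T \<Longrightarrow>
      \<exists>p\<in>monomials T. \<exists>q\<in>monomials T. same_fibre p q \<and> p \<noteq> 0 \<and>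
        Poly_Mapping.keys p \<inter> Poly_Mapping.keys q = {}"
begin

text \<open>The sum of the two points decomposes within the box of side at most 1 around its half, and this
lowers the energy.\<close>

lemma spread_pair_nonminimal:
  assumes z: "z \<in> V" "z' \<in> V" and spread: "c z a + 2 \<le> c z' a"
  shows "nonminimal (Poly_Mapping.single z 1 + Poly_Mapping.single z' 1)"
proof -
  let ?m = "Poly_Mapping.single z 1 + Poly_Mapping.single z' (1::nat)"
  let ?\<alpha> = "\<lambda>y. (if y = z then 1 else 0) + (if y = z' then 1 else (0::int))"
  define lo hi where "lo b = (c z b + c z' b) div 2" and "hi b = (c z b + c z' b + 1) div 2" for b
  have \<alpha>: "(\<Sum>y\<in>V. ?\<alpha> y * w y) = w z + w z'" for w :: "'x \<Rightarrow> int"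
    using z finite_V by (simp add: distrib_right sum.distrib if_distrib[of "\<lambda>t. t * _"] cong: if_cong)
  have m: "?m \<in> monomials V"
    using z by (auto simp: monomials_def keys_nat_add)
  obtain \<beta> where \<beta>: "\<beta> \<in> monomials V" "wdeg V (\<lambda>_. 1) \<beta> = int 2"
    "\<And>b. wdeg V (\<lambda>z. c z b) \<beta> = c z b + c z' b"
    "\<And>y b. y \<in> Poly_Mapping.keys \<beta> \<Longrightarrow> lo b \<le> c y b \<and> c y b \<le> hi b"
  proof -
    have "\<exists>\<beta>\<in>monomials V. wdeg V (\<lambda>_. 1) \<beta> = int 2 \<and>
        (\<forall>b. wdeg V (\<lambda>z. c z b) \<beta> = (\<Sum>y\<in>V. ?\<alpha> y * c y b)) \<and>
        (\<forall>y\<in>Poly_Mapping.keys \<beta>. \<forall>b. lo b \<le> c y b \<and> c y b \<le> hi b)"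
    proof (rule decompose)
      show "(\<Sum>z\<in>V. ?\<alpha> z) = int 2" using \<alpha>[of "\<lambda>_. 1"] by simp
      show "\<exists>p\<in>V. c p b \<le> lo b" for b
      proof (cases "c z b \<le> c z' b")
        case True
        then have "c z b \<le> lo b" unfolding lo_def by linarith
        then show ?thesis using z by blast
      next
        case False
        then have "c z' b \<le> lo b" unfolding lo_def by linarith
        then show ?thesis using z by blast
      qed
      show "\<exists>p\<in>V. hi b \<le> c p b" for b
      proof (cases "c z b \<le> c z' b")
        case True
        then have "hi b \<le> c z' b" unfolding hi_def by linarith
        then show ?thesis using z by blast
      next
        case False
        then have "hi b \<le> c z b" unfolding hi_def by linarith
        then show ?thesis using z by blast
      qed
    qed (auto simp: \<alpha> lo_def hi_def)
    then show ?thesis using that unfolding \<alpha> by blast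
  qed
  have same: "same_fibre ?m \<beta>"
    using \<beta> z by (simp add: same_fibre_def wdeg_add wdeg_single finite_V)
  have box: "in_unit_box lo \<beta>"
    unfolding in_unit_box_def
  proof (intro ballI allI)
    fix y b assume "y \<in> Poly_Mapping.keys \<beta>"
    moreover have "hi b \<le> lo b + 1" unfolding lo_def hi_def by linarith
    ultimately show "c y b = lo b \<or> c y b = lo b + 1" using \<beta>(4)[of y b] by linarith
  qed
  have "\<not> in_unit_box lo ?m"
  proof
    assume "in_unit_box lo ?m"
    moreover have "z \<in> Poly_Mapping.keys ?m" "z' \<in> Poly_Mapping.keys ?m"
      by (auto simp: keys_nat_add)
    ultimately have "c z a = lo a \<or> c z a = lo a + 1" "c z' a = lo a \<or> c z' a = lo a + 1"
      unfolding in_unit_box_def by blast+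
    then show False using spread by linarith
  qed
  then have "excess lo ?m > excess lo \<beta>"
    using box m \<beta>(1) excess_nonneg[of lo ?m] excess_eq_0_iff[of ?m lo] excess_eq_0_iff[of \<beta> lo] by linarith
  then have "energy \<beta> < energy ?m"
    using excess_diff_eq_energy_diff[OF same, of lo] by linarith
  then have "order_vector \<beta> < order_vector ?m"
    using same by (simp add: order_vector_def same_fibre_def)
  then show ?thesis
    unfolding nonminimal_def using m \<beta>(1) same by blast
qed

text \<open>The first variable \<open>z\<close> in \<open>m\<close> and \<open>n\<close> must divide \<open>n\<close>, otherwise \<open>m\<close> would be the smaller one. Where
a coordinate is constant on the support of \<open>m\<close> it is an extreme value of the box, so it has to be
constant on the support of \<open>n\<close> as well; in particular \<open>z\<close> shares it. This is what puts the sum of the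
support minus \<open>z\<close> inside the multiple of the box.\<close>

lemma squarefree_part_nonminimal:
  assumes m: "m \<in> monomials V" "in_unit_box k m"
    and n: "n \<in> monomials V" "same_fibre m n" "order_vector n < order_vector m"
    and disjoint: "Poly_Mapping.keys m \<inter> Poly_Mapping.keys n = {}"
  obtains xs z ys where "variables = xs @ z # ys" "in_unit_box k (Poly_Mapping.single z 1)" "z \<in> V"
    "Poly_Mapping.keys m \<inter> set (xs @ [z]) = {}" "nonminimal (squarefree_of (Poly_Mapping.keys m))"
proof -
  let ?S = "Poly_Mapping.keys m"
  have S: "?S \<subseteq> V" "finite ?S" using m by (auto simp: monomials_def)
  have n_box: "in_unit_box k n"
    using in_unit_box_smaller n m by blast
  have energy: "energy m = energy n"
    using energy_eq_in_unit_box m n n_box by blast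
  have "m \<noteq> n" using n by auto
  then have "?S \<union> Poly_Mapping.keys n \<noteq> {}"
    by (metis Un_empty keys_eq_empty)
  moreover have "?S \<union> Poly_Mapping.keys n \<subseteq> set variables"
    using m n by (simp add: monomials_def set_variables)
  ultimately have "\<exists>z\<in>set variables. z \<in> ?S \<union> Poly_Mapping.keys n" by blast
  then obtain xs z ys where split: "variables = xs @ z # ys" "z \<in> ?S \<union> Poly_Mapping.keys n"
    "\<forall>y\<in>set xs. y \<notin> ?S \<union> Poly_Mapping.keys n"
    using split_list_first_prop[of variables "\<lambda>z. z \<in> ?S \<union> Poly_Mapping.keys n"] by blast
  have "z \<notin> ?S"
  proof
    assume "z \<in> ?S"
    then have "order_vector m < order_vector n"
      using order_vector_revlex[OF split(1), of m n] split(3) disjoint n(2) energy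
      by (auto simp: same_fibre_def)
    then show False using n(3) by simp
  qed
  then have zn: "z \<in> Poly_Mapping.keys n" and zS: "?S \<inter> set (xs @ [z]) = {}"
    using split by auto
  have zV: "z \<in> V" using zn n by (auto simp: monomials_def)
  have z_box: "in_unit_box k (Poly_Mapping.single z 1)"
    using n_box zn by (auto simp: in_unit_box_def)
  have "?S \<noteq> {}"
  proof
    assume "?S = {}"
    then have "m = 0" by simp
    then have "wdeg V (\<lambda>_. 1) n = 0" using n(2) by (simp add: same_fibre_def)
    then show False using n(1) zn by (simp add: wdeg_eq_0_iff finite_V)
  qed
  have S_vals: "c y a = k a \<or> c y a = k a + 1" if "y \<in> ?S" for y a
    using m(2) that by (auto simp: in_unit_box_def)
  have n_vals: "c y a = k a \<or> c y a = k a + 1" if "y \<in> Poly_Mapping.keys n" for y a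
    using n_box that by (auto simp: in_unit_box_def)
  have z_vals: "c z a = k a \<or> c z a = k a + 1" for a
    using n_box zn by (auto simp: in_unit_box_def)
  \<comment> \<open>The smallest face of the unit box that contains the support of m.\<close>
  define lo hi where "lo a = (if \<forall>y\<in>?S. c y a = k a + 1 then k a + 1 else k a)"
    and "hi a = (if \<forall>y\<in>?S. c y a = k a then k a else k a + 1)" for a
  have z_lo: "c z a = k a + 1" if "\<forall>y\<in>?S. c y a = k a + 1" for a
  proof -
    have eq: "wdeg V (\<lambda>y. c y a - (k a + 1)) m = 0"
      unfolding wdeg_def using that by (intro sum.neutral) (auto simp: in_keys_iff)
    have "wdeg V (\<lambda>y. - 1 * (c y a - (k a + 1))) n = 0"
      unfolding wdeg_scale_weight using same_fibre_wdeg_shift[OF n(2), of a "k a + 1"] eq by simp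
    then have "(\<Sum>y\<in>Poly_Mapping.keys n. int (Poly_Mapping.lookup n y) * (k a + 1 - c y a)) = 0"
      unfolding wdeg_def using n(1) finite_V
      by (subst (asm) sum.mono_neutral_right[of V "Poly_Mapping.keys n"])
        (auto simp: monomials_def in_keys_iff algebra_simps)
    moreover have "0 \<le> k a + 1 - c y a" if "y \<in> Poly_Mapping.keys n" for y
      using n_vals[OF that, of a] by auto
    ultimately have "int (Poly_Mapping.lookup n z) * (k a + 1 - c z a) = 0"
      using zn by (subst (asm) sum_nonneg_eq_0_iff) auto
    then show ?thesis using zn by (simp add: in_keys_iff)
  qed
  have z_hi: "c z a = k a" if "\<forall>y\<in>?S. c y a = k a" for a
  proof -
    have eq: "wdeg V (\<lambda>y. c y a - k a) m = 0"
      unfolding wdeg_def using that by (intro sum.neutral) (auto simp: in_keys_iff)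
    have "wdeg V (\<lambda>y. c y a - k a) n = 0"
      using same_fibre_wdeg_shift[OF n(2), of a "k a"] eq by simp
    then have "(\<Sum>y\<in>Poly_Mapping.keys n. int (Poly_Mapping.lookup n y) * (c y a - k a)) = 0"
      unfolding wdeg_def using n(1) finite_V
      by (subst (asm) sum.mono_neutral_right[of V "Poly_Mapping.keys n"])
        (auto simp: monomials_def in_keys_iff algebra_simps)
    moreover have "0 \<le> c y a - k a" if "y \<in> Poly_Mapping.keys n" for y
      using n_vals[OF that, of a] by auto
    ultimately have "int (Poly_Mapping.lookup n z) * (c z a - k a) = 0"
      using zn by (subst (asm) sum_nonneg_eq_0_iff) auto
    then show ?thesis using zn by (simp add: in_keys_iff)
  qed
  let ?\<alpha> = "\<lambda>y. (if y \<in> ?S then 1 else 0) - (if y = z then 1 else (0::int))"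
  have \<alpha>: "(\<Sum>y\<in>V. ?\<alpha> y * w y) = (\<Sum>y\<in>?S. w y) - w z" for w :: "'x \<Rightarrow> int"
    using S zV finite_V
    by (simp add: left_diff_distrib sum_subtractf if_distrib[of "\<lambda>t. t * _"]
        sum.inter_restrict[symmetric] Int_absorb1 cong: if_cong)
  define D where "D = card ?S - 1"
  have D: "card ?S = Suc D" using \<open>?S \<noteq> {}\<close> S by (simp add: D_def card_gt_0_iff)
  have lower: "int D * lo a \<le> (\<Sum>y\<in>?S. c y a) - c z a" for a
  proof (cases "\<forall>y\<in>?S. c y a = k a + 1")
    case True
    then show ?thesis using z_lo[OF True] D by (simp add: lo_def algebra_simps)
  next
    case False
    show ?thesis
    proof (cases "\<forall>y\<in>?S. c y a = k a")
      case all: True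
      then show ?thesis using z_hi[OF all] D False by (simp add: lo_def algebra_simps)
    next
      case some: False
      then obtain y where y: "y \<in> ?S" "c y a = k a + 1" using S_vals by blast
      have "(\<Sum>y\<in>?S - {y}. c y a) \<ge> (\<Sum>y\<in>?S - {y}. k a)"
        using S_vals by (intro sum_mono) (metis DiffD1 order_refl zle_add1_eq_le less_add_one less_imp_le)
      moreover have "(\<Sum>y\<in>?S - {y}. k a) = int D * k a"
        using y D S by simp
      moreover have "(\<Sum>y\<in>?S. c y a) = c y a + (\<Sum>y\<in>?S - {y}. c y a)"
        using y S by (simp add: sum.remove)
      ultimately show ?thesis using z_vals[of a] y False by (auto simp: lo_def)
    qed
  qed
  have upper: "(\<Sum>y\<in>?S. c y a) - c z a \<le> int D * hi a" for a
  proof (cases "\<forall>y\<in>?S. c y a = k a")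
    case True
    then show ?thesis using z_hi[OF True] D by (simp add: hi_def algebra_simps)
  next
    case False
    show ?thesis
    proof (cases "\<forall>y\<in>?S. c y a = k a + 1")
      case all: True
      then show ?thesis using z_lo[OF all] D False by (simp add: hi_def algebra_simps)
    next
      case some: False
      then obtain y where y: "y \<in> ?S" "c y a = k a" using S_vals by blast
      have "(\<Sum>y\<in>?S - {y}. c y a) \<le> (\<Sum>y\<in>?S - {y}. k a + 1)"
        using S_vals by (intro sum_mono) (metis DiffD1 order_refl less_add_one less_imp_le)
      moreover have "(\<Sum>y\<in>?S - {y}. k a + 1) = int D * (k a + 1)"
        using y D S by simp
      moreover have "(\<Sum>y\<in>?S. c y a) = c y a + (\<Sum>y\<in>?S - {y}. c y a)"
        using y S by (simp add: sum.remove)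
      ultimately show ?thesis using z_vals[of a] y False by (auto simp: hi_def)
    qed
  qed
  obtain \<beta> where \<beta>: "\<beta> \<in> monomials V" "wdeg V (\<lambda>_. 1) \<beta> = int D"
    "\<And>a. wdeg V (\<lambda>z. c z a) \<beta> = (\<Sum>y\<in>?S. c y a) - c z a"
    "\<And>y a. y \<in> Poly_Mapping.keys \<beta> \<Longrightarrow> lo a \<le> c y a \<and> c y a \<le> hi a"
  proof -
    have "\<exists>\<beta>\<in>monomials V. wdeg V (\<lambda>_. 1) \<beta> = int D \<and>
        (\<forall>a. wdeg V (\<lambda>z. c z a) \<beta> = (\<Sum>y\<in>V. ?\<alpha> y * c y a)) \<and>
        (\<forall>y\<in>Poly_Mapping.keys \<beta>. \<forall>a. lo a \<le> c y a \<and> c y a \<le> hi a)"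
    proof (rule decompose)
      show "(\<Sum>z\<in>V. ?\<alpha> z) = int D" using \<alpha>[of "\<lambda>_. 1"] D by simp
      show "\<exists>p\<in>V. c p a \<le> lo a" for a
      proof (cases "\<forall>y\<in>?S. c y a = k a + 1")
        case True
        obtain y where "y \<in> ?S" using \<open>?S \<noteq> {}\<close> by blast
        then show ?thesis using True S(1) by (intro bexI[of _ y]) (auto simp: lo_def)
      next
        case False
        then obtain y where "y \<in> ?S" "c y a = k a" using S_vals by blast
        then show ?thesis using False S(1) by (intro bexI[of _ y]) (auto simp: lo_def)
      qed
      show "\<exists>p\<in>V. hi a \<le> c p a" for a
      proof (cases "\<forall>y\<in>?S. c y a = k a")
        case True
        obtain y where "y \<in> ?S" using \<open>?S \<noteq> {}\<close> by blast
        then show ?thesis using True S(1) by (intro bexI[of _ y]) (auto simp: hi_def)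
      next
        case False
        then obtain y where "y \<in> ?S" "c y a = k a + 1" using S_vals by blast
        then show ?thesis using False S(1) by (intro bexI[of _ y]) (auto simp: hi_def)
      qed
    qed (simp_all only: \<alpha> lower upper)
    then show ?thesis using that unfolding \<alpha> by blast
  qed
  let ?n = "\<beta> + Poly_Mapping.single z 1"
  let ?s = "squarefree_of ?S"
  have nV: "?n \<in> monomials V" and sV: "?s \<in> monomials V"
    using \<beta>(1) zV S by (auto simp: monomials_def keys_nat_add keys_squarefree_of)
  have same: "same_fibre ?s ?n"
    using \<beta> D S zV by (simp add: same_fibre_def wdeg_add wdeg_single finite_V wdeg_squarefree_of)
  have "in_unit_box k \<beta>"
    unfolding in_unit_box_def
  proof (intro ballI allI)
    fix y a assume "y \<in> Poly_Mapping.keys \<beta>"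
    then have "lo a \<le> c y a \<and> c y a \<le> hi a" by (rule \<beta>(4))
    moreover have "k a \<le> lo a" "hi a \<le> k a + 1" by (auto simp: lo_def hi_def)
    ultimately show "c y a = k a \<or> c y a = k a + 1" by linarith
  qed
  then have "in_unit_box k ?n" "in_unit_box k ?s"
    using z_vals m S by (auto simp: in_unit_box_def keys_nat_add keys_squarefree_of)
  then have "energy ?s = energy ?n"
    using energy_eq_in_unit_box[OF same] nV sV by blast
  then have "order_vector ?n < order_vector ?s"
    using same zS by (intro order_vector_revlex[OF split(1)])
      (auto simp: same_fibre_def keys_nat_add keys_squarefree_of)
  then have "nonminimal ?s" unfolding nonminimal_def using nV sV same by blast
  then show ?thesis using that split(1) z_box zV zS by blast
qed

lemma unit_box_of_small_spread:
  assumes "m \<in> monomials V"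
    and "\<And>z z' a. z \<in> Poly_Mapping.keys m \<Longrightarrow> z' \<in> Poly_Mapping.keys m \<Longrightarrow> c z' a \<le> c z a + 1"
  obtains k where "in_unit_box k m"
proof -
  have "in_unit_box (\<lambda>a. Min ((\<lambda>z. c z a) ` Poly_Mapping.keys m)) m"
    unfolding in_unit_box_def
  proof (intro ballI allI)
    fix z a assume z: "z \<in> Poly_Mapping.keys m"
    let ?C = "(\<lambda>z. c z a) ` Poly_Mapping.keys m"
    have "Min ?C \<in> ?C" using z by (intro Min_in) auto
    then have "c z a \<le> Min ?C + 1" using assms(2) z by auto
    moreover have "Min ?C \<le> c z a" using z by simp
    ultimately show "c z a = Min ?C \<or> c z a = Min ?C + 1" by linarith
  qed
  then show ?thesis using that by blast
qed

lemma minimal_generator_eqI: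
  assumes "minimal_generator m" "nonminimal g"
    and "\<And>z. Poly_Mapping.lookup g z \<le> Poly_Mapping.lookup m z"
  shows "m = g"
proof -
  obtain k where k: "m = g + k" by (rule divisor_eqI[OF assms(3)])
  then have "k = 0" using assms(1,2) unfolding minimal_generator_def by blast
  then show ?thesis using k by simp
qed

lemma minimal_generator_unit_box:
  assumes m: "minimal_generator m" and box: "in_unit_box k m"
  obtains xs z ys where "variables = xs @ z # ys" "in_unit_box k (Poly_Mapping.single z 1)" "z \<in> V"
    "Poly_Mapping.keys m \<inter> set (xs @ [z]) = {}" "m = squarefree_of (Poly_Mapping.keys m)"
proof -
  have mV: "m \<in> monomials V" and "nonminimal m"
    using m by (auto simp: minimal_generator_def nonminimal_def)
  then obtain n where n: "n \<in> monomials V" "same_fibre m n" "order_vector n < order_vector m"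
    by (auto simp: nonminimal_def)
  obtain xs z ys where xs: "variables = xs @ z # ys" "in_unit_box k (Poly_Mapping.single z 1)" "z \<in> V"
    "Poly_Mapping.keys m \<inter> set (xs @ [z]) = {}" "nonminimal (squarefree_of (Poly_Mapping.keys m))"
    using squarefree_part_nonminimal[OF mV box n minimal_generator_disjoint[OF m n]] by blast
  have "m = squarefree_of (Poly_Mapping.keys m)"
    by (rule minimal_generator_eqI[OF m xs(5)]) (auto simp: lookup_squarefree_of in_keys_iff)
  then show ?thesis using xs that by blast
qed

text \<open>A minimal generator dividing \<open>p\<close> is square-free, hence divides \<open>m\<close>, hence equals \<open>m\<close>.\<close>

lemma nonminimal_full_support:
  assumes m: "minimal_generator m" and box: "in_unit_box k m"
    and p: "nonminimal p" "Poly_Mapping.keys p \<subseteq> Poly_Mapping.keys m"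
  shows "Poly_Mapping.keys p = Poly_Mapping.keys m"
proof -
  obtain g l where g: "minimal_generator g" "p = g + l"
    using minimal_generator_divides[OF p(1)] by metis
  have keys_g: "Poly_Mapping.keys g \<subseteq> Poly_Mapping.keys p"
    using g by (auto simp: keys_nat_add)
  then have "in_unit_box k g" using box p by (auto simp: in_unit_box_def)
  then have "g = squarefree_of (Poly_Mapping.keys g)"
    using minimal_generator_unit_box[OF g(1)] by metis
  then have "Poly_Mapping.lookup g z \<le> Poly_Mapping.lookup m z" for z
    using keys_g p(2)
    by (metis finite_keys in_keys_iff lookup_squarefree_of not_less_eq_eq le_0_eq One_nat_def subset_iff nat_le_linear)
  then have "m = g"
    using g(1) by (intro minimal_generator_eqI[OF m]) (auto simp: minimal_generator_def)
  then show ?thesis using keys_g p(2) by blast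
qed

text \<open>With more than \<open>d\<close> points in the support there is a dependence among them and the variable \<open>z\<close> that
precedes them. One side of it is nonminimal and has, by minimality of \<open>m\<close>, the full support of \<open>m\<close>,
so that \<open>z\<close> is a convex combination of the support. This is impossible, since distinct lattice points
of a unit box are in convex position.\<close>

lemma minimal_generator_degree:
  assumes m: "minimal_generator m" and box: "in_unit_box k m"
  shows "card (Poly_Mapping.keys m) \<le> d"
proof (rule ccontr)
  assume "\<not> ?thesis"
  then have large: "d + 1 \<le> card (Poly_Mapping.keys m)" by simp
  let ?S = "Poly_Mapping.keys m"
  obtain xs z ys where z: "variables = xs @ z # ys" "in_unit_box k (Poly_Mapping.single z 1)" "z \<in> V"
    "?S \<inter> set (xs @ [z]) = {}"
    using minimal_generator_unit_box[OF m box] by metis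
  have SV: "?S \<subseteq> V" using m by (auto simp: minimal_generator_def nonminimal_def monomials_def)
  have zS: "z \<notin> ?S" using z by auto
  have "d + 2 \<le> card (insert z ?S)" using large zS by simp
  then obtain p q where pq: "p \<in> monomials (insert z ?S)" "q \<in> monomials (insert z ?S)"
    "same_fibre p q" "p \<noteq> 0" "Poly_Mapping.keys p \<inter> Poly_Mapping.keys q = {}"
    using dependent[of "insert z ?S"] z(3) SV by auto
  have z_box: "c z a = k a \<or> c z a = k a + 1" for a
    using z(2) by (simp add: in_unit_box_def)
  have mono: "r \<in> monomials V \<and> in_unit_box k r" if "r \<in> monomials (insert z ?S)" for r
  proof
    show "r \<in> monomials V" using that SV z(3) by (auto simp: monomials_def)
    show "in_unit_box k r"
      unfolding in_unit_box_def
    proof (intro ballI allI)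
      fix y a assume "y \<in> Poly_Mapping.keys r"
      then have "y = z \<or> y \<in> ?S" using that by (auto simp: monomials_def)
      then show "c y a = k a \<or> c y a = k a + 1"
        using z_box box unfolding in_unit_box_def by blast
    qed
  qed
  have sym: "same_fibre q p" using pq(3) by (simp add: same_fibre_def)
  have q0: "q \<noteq> 0"
  proof
    assume "q = 0"
    then have "wdeg V (\<lambda>_. 1) p = 0" using pq(3) by (simp add: same_fibre_def)
    then show False using pq(1,4) mono by (simp add: wdeg_eq_0_iff finite_V)
  qed
  \<comment> \<open>The variable z precedes those of m, so it makes its side of the relation the smaller one.\<close>
  have key: False
    if r: "r \<in> monomials (insert z ?S)" "s \<in> monomials (insert z ?S)" "same_fibre r s"
      "z \<in> Poly_Mapping.keys s" "Poly_Mapping.keys r \<inter> Poly_Mapping.keys s = {}" for r s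
  proof -
    have rS: "Poly_Mapping.keys r \<subseteq> ?S" using r by (auto simp: monomials_def)
    have "order_vector s < order_vector r"
      using order_vector_revlex[OF z(1) r(4), of r] rS z(4) r(3)
        energy_eq_in_unit_box[OF r(3)] mono[OF r(1)] mono[OF r(2)] by (auto simp: same_fibre_def)
    then have "nonminimal r" unfolding nonminimal_def using mono r by blast
    then have keys_r: "Poly_Mapping.keys r = ?S" using nonminimal_full_support[OF m box] rS by blast
    then have keys_s: "Poly_Mapping.keys s = {z}" using r by (auto simp: monomials_def)
    obtain y where y: "y \<in> ?S" using large by (metis One_nat_def add_leD2 card.empty ex_in_conv not_one_le_zero)
    have "c y a = c z a" for a
    proof -
      \<comment> \<open>On the unit box, e times the deviation from the coordinate of z is nonnegative.\<close>
      define e :: int where "e = (if c z a = k a then 1 else - 1)"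
      have sgn: "0 \<le> e * (c x a - c z a)" if "x \<in> insert z ?S" for x
      proof (cases "x = z")
        case False
        then have "c x a = k a \<or> c x a = k a + 1"
          using that box unfolding in_unit_box_def by blast
        then show ?thesis using z_box[of a] by (auto simp: e_def)
      qed simp
      have "wdeg V (\<lambda>x. c x a - c z a) s = 0"
        unfolding wdeg_def using keys_s
        by (intro sum.neutral) (auto simp: in_keys_iff set_eq_iff)
      then have "wdeg V (\<lambda>x. c x a - c z a) r = 0"
        using same_fibre_wdeg_shift[OF r(3), of a "c z a"] by simp
      then have "(\<Sum>x\<in>V. int (Poly_Mapping.lookup r x) * (e * (c x a - c z a))) = 0"
        using wdeg_scale_weight[of V e "\<lambda>x. c x a - c z a" r] by (simp add: wdeg_def)
      moreover have "0 \<le> int (Poly_Mapping.lookup r x) * (e * (c x a - c z a))" for x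
        using sgn[of x] keys_r by (cases "x \<in> ?S") (auto simp: in_keys_iff)
      ultimately have "\<forall>x\<in>V. int (Poly_Mapping.lookup r x) * (e * (c x a - c z a)) = 0"
        using finite_V by (subst (asm) sum_nonneg_eq_0_iff) auto
      then have "int (Poly_Mapping.lookup r y) * (e * (c y a - c z a)) = 0"
        using y SV by blast
      moreover have "e \<noteq> 0" by (simp add: e_def)
      ultimately show ?thesis using y keys_r by (auto simp: in_keys_iff)
    qed
    then have "c y = c z" by (rule ext)
    then have "y = z" using inj_onD[OF inj_c] y SV z(3) by blast
    then show False using y zS by simp
  qed
  show False
  proof (cases "z \<in> Poly_Mapping.keys p \<union> Poly_Mapping.keys q")
    case True
    then show False using key[of q p] key[of p q] pq sym by auto
  next
    case False
    then have sub: "Poly_Mapping.keys p \<subseteq> ?S" "Poly_Mapping.keys q \<subseteq> ?S"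
      using pq by (auto simp: monomials_def)
    have "order_vector p \<noteq> order_vector q"
      using order_vector_inj[of p q] mono pq q0 by (metis Int_absorb keys_eq_empty)
    then have "nonminimal p \<or> nonminimal q"
      unfolding nonminimal_def using pq sym mono by (metis linorder_less_linear)
    then have "Poly_Mapping.keys p = ?S \<or> Poly_Mapping.keys q = ?S"
      using nonminimal_full_support[OF m box] sub by blast
    then show False using pq q0 sub by (metis inf.absorb1 inf.absorb2 keys_eq_empty)
  qed
qed

text \<open>A generator with two factors far apart has degree 2. Then \<open>d\<close> is not 0, since two distinct points
of \<open>V\<close> are affinely independent; so excluding \<open>d = 1\<close> leaves \<open>2 \<le> d\<close>.\<close>

lemma minimal_generator_bounds:
  assumes m: "minimal_generator m" and "d \<noteq> 1"
  shows "squarefree_mono m \<and> mono_degree m \<le> d"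
proof -
  have mV: "m \<in> monomials V" using m by (auto simp: minimal_generator_def nonminimal_def)
  show ?thesis
  proof (cases "\<exists>z z' a. z \<in> Poly_Mapping.keys m \<and> z' \<in> Poly_Mapping.keys m \<and> c z a + 2 \<le> c z' a")
    case True
    then obtain z z' a where z: "z \<in> Poly_Mapping.keys m" "z' \<in> Poly_Mapping.keys m" "c z a + 2 \<le> c z' a"
      by blast
    have zV: "z \<in> V" "z' \<in> V" using z mV by (auto simp: monomials_def)
    have ne: "z \<noteq> z'" using z by auto
    let ?t = "Poly_Mapping.single z 1 + Poly_Mapping.single z' (1::nat)"
    have m_eq: "m = ?t"
      using z ne by (intro minimal_generator_eqI[OF m spread_pair_nonminimal[OF zV z(3)]])
        (auto simp: lookup_add lookup_single when_def in_keys_iff)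
    have "\<not> d + 2 \<le> 2"
    proof
      assume "d + 2 \<le> 2"
      then obtain p q where pq: "p \<in> monomials {z, z'}" "q \<in> monomials {z, z'}" "same_fibre p q" "p \<noteq> 0"
        "Poly_Mapping.keys p \<inter> Poly_Mapping.keys q = {}"
        using dependent[of "{z, z'}"] zV ne by auto
      have V: "p \<in> monomials V" "q \<in> monomials V" using pq zV by (auto simp: monomials_def)
      have two: "wdeg V w r = int (Poly_Mapping.lookup r z) * w z + int (Poly_Mapping.lookup r z') * w z'"
        if "r \<in> monomials {z, z'}" for r w
      proof -
        have "wdeg V w r = (\<Sum>x\<in>{z, z'}. int (Poly_Mapping.lookup r x) * w x)"
          unfolding wdeg_def using that zV finite_V
          by (intro sum.mono_neutral_right) (auto simp: monomials_def in_keys_iff)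
        then show ?thesis using ne by simp
      qed
      have deg: "int (Poly_Mapping.lookup p z) + int (Poly_Mapping.lookup p z') =
          int (Poly_Mapping.lookup q z) + int (Poly_Mapping.lookup q z')"
        using pq(3) two[OF pq(1)] two[OF pq(2)] by (simp add: same_fibre_def)
      have ca: "int (Poly_Mapping.lookup p z) * c z a + int (Poly_Mapping.lookup p z') * c z' a =
          int (Poly_Mapping.lookup q z) * c z a + int (Poly_Mapping.lookup q z') * c z' a"
        using pq(3) two[OF pq(1)] two[OF pq(2)] by (simp add: same_fibre_def)
      have "(int (Poly_Mapping.lookup p z') - int (Poly_Mapping.lookup q z')) * (c z' a - c z a) = 0"
      proof -
        have eq: "int (Poly_Mapping.lookup p z) =
            int (Poly_Mapping.lookup q z) + int (Poly_Mapping.lookup q z') - int (Poly_Mapping.lookup p z')"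
          using deg by simp
        show ?thesis using ca unfolding eq by (simp add: algebra_simps)
      qed
      then have "Poly_Mapping.lookup p z' = Poly_Mapping.lookup q z'" using z(3) by auto
      moreover from this have "Poly_Mapping.lookup p z = Poly_Mapping.lookup q z" using deg by auto
      moreover have "Poly_Mapping.lookup p x = 0 \<or> Poly_Mapping.lookup q x = 0" for x
        using pq(5) by (auto simp: in_keys_iff set_eq_iff)
      ultimately have "Poly_Mapping.lookup p z = 0" "Poly_Mapping.lookup p z' = 0"
        by metis+
      then have "z \<notin> Poly_Mapping.keys p" "z' \<notin> Poly_Mapping.keys p"
        by (simp_all add: in_keys_iff)
      then have "Poly_Mapping.keys p = {}"
        using pq(1) by (auto simp only: monomials_def)
      then show False using pq by simp
    qed
    then have "2 \<le> d" using \<open>d \<noteq> 1\<close> by simp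
    moreover have "mono_degree m = 2"
      using wdeg_degree[OF finite_V mV] zV m_eq
      by (simp add: wdeg_add wdeg_single finite_V)
    moreover have "squarefree_mono m"
      using ne m_eq by (auto simp: squarefree_mono_def lookup_add lookup_single when_def)
    ultimately show ?thesis by simp
  next
    case False
    then obtain k where k: "in_unit_box k m"
      by (metis unit_box_of_small_spread[OF mV] not_le zless_imp_add1_zle add.assoc one_add_one)
    have m_eq: "m = squarefree_of (Poly_Mapping.keys m)"
      using minimal_generator_unit_box[OF m k] by metis
    have "squarefree_mono m"
      unfolding squarefree_mono_def by (subst m_eq) (simp add: lookup_squarefree_of)
    moreover have "mono_degree m = card (Poly_Mapping.keys m)"
      unfolding mono_degree_def
      by (subst m_eq, subst sum.cong[OF refl, of _ _ "\<lambda>_. 1"]) (auto simp: lookup_squarefree_of)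
    ultimately show ?thesis using minimal_generator_degree[OF m k] by simp
  qed
qed

end

section \<open>Rounding and decomposing flows\<close>

lemma Ints_strictly_between:
  fixes x :: real
  assumes "x \<notin> \<int>"
  shows "of_int \<lfloor>x\<rfloor> < x" "x < of_int \<lceil>x\<rceil>"
proof -
  have "of_int \<lfloor>x\<rfloor> \<noteq> x" "of_int \<lceil>x\<rceil> \<noteq> x"
    using assms by (metis Ints_of_int)+
  then show "of_int \<lfloor>x\<rfloor> < x" "x < of_int \<lceil>x\<rceil>"
    using of_int_floor_le[of x] le_of_int_ceiling[of x] by linarith+
qed

lemma vec_in_span_axes:
  fixes x :: "real ^ 'e::finite"
  assumes "\<And>a. a \<notin> F \<Longrightarrow> x $ a = 0"
  shows "x \<in> span ((\<lambda>a. axis a 1) ` F)"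
proof -
  have "x = (\<Sum>a\<in>UNIV. x $ a *\<^sub>R axis a 1)"
    by (simp add: vec_eq_iff axis_def if_distrib[of "\<lambda>t. _ * t"] cong: if_cong)
  also have "\<dots> = (\<Sum>a\<in>F. x $ a *\<^sub>R axis a 1)"
    by (rule sum.mono_neutral_right) (auto simp: assms)
  also have "\<dots> \<in> span ((\<lambda>a. axis a 1) ` F)"
    by (intro span_sum span_scale span_base) auto
  finally show ?thesis .
qed

lemma span_axes_vanish:
  fixes x :: "real ^ 'e::finite"
  assumes "x \<in> span ((\<lambda>a. axis a 1) ` F)" "a \<notin> F"
  shows "x $ a = 0"
proof -
  have "subspace {x :: real ^ 'e. x $ a = 0}"
    by (auto simp: subspace_def)
  moreover have "(\<lambda>a. axis a 1) ` F \<subseteq> {x :: real ^ 'e. x $ a = 0}"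
    using assms(2) by (auto simp: axis_def)
  ultimately show ?thesis using span_minimal assms(1) by blast
qed

lemma dim_span_axes:
  "dim ((\<lambda>a. axis a 1 :: real ^ 'e::finite) ` F) = card F"
proof -
  have "inj_on (\<lambda>a. axis a 1 :: real ^ 'e) F"
    by (auto simp: inj_on_def axis_eq_axis)
  moreover have "independent ((\<lambda>a. axis a 1 :: real ^ 'e) ` F)"
    by (rule independent_mono[OF independent_Basis]) (auto simp: Basis_vec_def)
  ultimately show ?thesis by (simp add: dim_eq_card_independent card_image)
qed

definition net_flow :: "('v, 'e::finite) pre_digraph \<Rightarrow> 'v \<Rightarrow> real ^ 'e \<Rightarrow> real" where
  "net_flow Q v x = (\<Sum>a\<in>in_arcs Q v. x $ a) - (\<Sum>a\<in>out_arcs Q v. x $ a)"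

lemma net_flow_add: "net_flow Q v (x + y) = net_flow Q v x + net_flow Q v y"
  by (simp add: net_flow_def sum.distrib)

lemma net_flow_diff: "net_flow Q v (x - y) = net_flow Q v x - net_flow Q v y"
  by (simp add: net_flow_def sum_subtractf)

lemma net_flow_scale: "net_flow Q v (k *\<^sub>R x) = k * net_flow Q v x"
  by (simp add: net_flow_def sum_distrib_left right_diff_distrib)

lemma net_flow_eq_inner:
  "net_flow Q v x = (\<chi> a. if a \<in> arcs Q then of_bool (head Q a = v) - of_bool (tail Q a = v) else 0) \<bullet> x"
proof -
  have "(\<chi> a. if a \<in> arcs Q then of_bool (head Q a = v) - of_bool (tail Q a = v) else 0) \<bullet> x =
    (\<Sum>a\<in>UNIV. (if a \<in> arcs Q \<and> head Q a = v then x $ a else 0) -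
       (if a \<in> arcs Q \<and> tail Q a = v then x $ a else 0))"
    unfolding inner_vec_def by (rule sum.cong) (auto simp: algebra_simps)
  also have "\<dots> = net_flow Q v x"
    by (simp add: sum_subtractf net_flow_def in_arcs_def out_arcs_def sum.If_cases Int_def)
  finally show ?thesis ..
qed

lemma weight_space_iff:
  "x \<in> weight_space Q \<theta> \<longleftrightarrow>
     (\<forall>a. a \<notin> arcs Q \<longrightarrow> x $ a = 0) \<and> (\<forall>v\<in>verts Q. net_flow Q v x = of_int (\<theta> v))"
  by (simp add: weight_space_def net_flow_def)

lemma card_filter_eq_sum: "finite A \<Longrightarrow> card {x \<in> A. R x} = (\<Sum>x\<in>A. of_bool (R x))"
  unfolding card_eq_sum of_bool_def by (rule sum.inter_filter)

text \<open>If every vertex touched by \<open>F\<close> is touched by at least two arrows of \<open>F\<close>, then \<open>F\<close> touches at most as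
many vertices as it has arrows. Conservation at all but one of these vertices implies conservation
at the last one, so there are fewer independent linear conditions than arrows, and a nonzero
solution exists. (Combinatorially, \<open>F\<close> contains a cycle of the underlying undirected graph.)\<close>

lemma nonzero_circulation:
  fixes Q :: "('v, 'e::finite) pre_digraph"
  assumes Q: "quiver Q" and F: "F \<subseteq> arcs Q" "F \<noteq> {}"
    and two: "\<And>v b. b \<in> F \<Longrightarrow> v = head Q b \<or> v = tail Q b \<Longrightarrow>
      \<exists>b'\<in>F. b' \<noteq> b \<and> (v = head Q b' \<or> v = tail Q b')"
  obtains x :: "real ^ 'e" where "x \<noteq> 0" "\<And>a. a \<notin> F \<Longrightarrow> x $ a = 0" "\<And>v. net_flow Q v x = 0"
proof -
  interpret loopfree_digraph Q using Q by (simp add: quiver_def)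
  have "finite F" by simp
  let ?U = "head Q ` F \<union> tail Q ` F"
  let ?I = "\<lambda>v. {a \<in> F. head Q a = v \<or> tail Q a = v}"
  have finU: "finite ?U" by simp
  have "2 \<le> card (?I v)" if v: "v \<in> ?U" for v
  proof -
    obtain b where b: "b \<in> F" "v = head Q b \<or> v = tail Q b" using v by blast
    then obtain b' where b': "b' \<in> F" "b' \<noteq> b" "v = head Q b' \<or> v = tail Q b'" using two by blast
    have "card {b, b'} \<le> card (?I v)" using b b' by (intro card_mono) auto
    then show ?thesis using b'(2) by simp
  qed
  then have "card ?U * 2 \<le> (\<Sum>v\<in>?U. card (?I v))"
    using sum_mono[of ?U "\<lambda>_. 2" "\<lambda>v. card (?I v)"] by simp
  also have "\<dots> = (\<Sum>a\<in>F. card {v \<in> ?U. head Q a = v \<or> tail Q a = v})"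
  proof -
    have "(\<Sum>v\<in>?U. card (?I v)) = (\<Sum>v\<in>?U. \<Sum>a\<in>F. of_bool (head Q a = v \<or> tail Q a = v))"
      by (simp only: card_filter_eq_sum[OF \<open>finite F\<close>])
    also have "\<dots> = (\<Sum>a\<in>F. \<Sum>v\<in>?U. of_bool (head Q a = v \<or> tail Q a = v))"
      by (rule sum.swap)
    finally show ?thesis by (simp only: card_filter_eq_sum[OF finU])
  qed
  also have "\<dots> \<le> (\<Sum>a\<in>F. 2)"
  proof (rule sum_mono)
    fix a
    have "card {v \<in> ?U. head Q a = v \<or> tail Q a = v} \<le> card {head Q a, tail Q a}"
      by (rule card_mono) auto
    also have "\<dots> \<le> 2" by (simp add: card_insert_if)
    finally show "card {v \<in> ?U. head Q a = v \<or> tail Q a = v} \<le> 2" .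
  qed
  finally have UF: "card ?U \<le> card F" by simp
  obtain v0 where v0: "v0 \<in> ?U" using F by auto
  define r :: "'v \<Rightarrow> real ^ 'e" where
    "r v = (\<chi> a. if a \<in> F then of_bool (head Q a = v) - of_bool (tail Q a = v) else 0)" for v
  let ?S = "r ` (?U - {v0})" and ?T = "(\<lambda>a. axis a 1 :: real ^ 'e) ` F"
  have sub: "span ?S \<subseteq> span ?T"
    by (rule span_minimal) (auto intro!: vec_in_span_axes simp: r_def)
  have "dim ?S \<le> card ?S" by (rule dim_le_card') simp
  also have "\<dots> \<le> card (?U - {v0})" by (rule card_image_le) simp
  also have "\<dots> < card ?U" using v0 finU by (intro psubset_card_mono) auto
  finally have "dim ?S < dim ?T" using UF by (simp only: dim_span_axes)
  then have "span ?S \<subset> span ?T" using sub by (metis dim_span order_less_irrefl psubsetI)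
  then obtain x where x: "x \<noteq> 0" "x \<in> span ?T" "\<And>y. y \<in> span ?S \<Longrightarrow> orthogonal x y"
    by (rule orthogonal_to_subspace_exists_gen) auto
  have x0: "x $ a = 0" if "a \<notin> F" for a using span_axes_vanish[OF x(2) that] .
  have net: "net_flow Q v x = r v \<bullet> x" for v
    unfolding net_flow_eq_inner inner_vec_def r_def
    by (rule sum.cong) (use x0 F in auto)
  have zero: "net_flow Q v x = 0" if "v \<noteq> v0" for v
  proof (cases "v \<in> ?U")
    case True
    then have "orthogonal x (r v)" using that by (intro x(3) span_base) auto
    then show ?thesis by (simp add: net orthogonal_def inner_commute)
  next
    case False
    then have "r v = 0" by (auto simp: r_def vec_eq_iff)
    then show ?thesis by (simp add: net)
  qed
  \<comment> \<open>Every arc leaves one vertex and enters another, so the net flows add up to zero; this takes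
    care of the vertex left out above.\<close>
  have "(\<Sum>v\<in>?U. r v) = 0"
  proof -
    have "(\<Sum>v\<in>?U. r v $ a) = 0" for a
    proof (cases "a \<in> F")
      case True
      then have "head Q a \<in> ?U" "tail Q a \<in> ?U" by auto
      then show ?thesis using True finU
        by (simp add: r_def sum_subtractf of_bool_def del: Un_iff)
    qed (simp add: r_def)
    then show ?thesis by (simp add: vec_eq_iff)
  qed
  then have "(\<Sum>v\<in>?U. net_flow Q v x) = 0"
    unfolding net by (simp add: inner_sum_left[symmetric])
  then have "net_flow Q v0 x = 0"
    using zero v0 finU by (subst (asm) sum.remove[of _ v0]) auto
  then have "net_flow Q v x = 0" for v using zero by (cases "v = v0") auto
  then show ?thesis using that x(1) x0 by blast
qed

text \<open>The unimodularity of flow problems. At every vertex the net flow is integral, so no vertex meets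
exactly one arrow with a fractional value, and there is a circulation on the arrows with fractional
values. Moving along it until a further value becomes integral never crosses an integer.\<close>

lemma integral_flow_rounding:
  fixes Q :: "('v, 'e::finite) pre_digraph"
  assumes Q: "quiver Q" and "x \<in> weight_space Q \<theta>"
  shows "\<exists>w\<in>weight_space Q \<theta> \<inter> int_points.
    \<forall>a. of_int \<lfloor>x $ a\<rfloor> \<le> w $ a \<and> w $ a \<le> of_int \<lceil>x $ a\<rceil>"
  using assms(2)
proof (induction "card {a. x $ a \<notin> \<int>}" arbitrary: x rule: less_induct)
  case less
  let ?F = "{a. x $ a \<notin> \<int>}"
  interpret loopfree_digraph Q using Q by (simp add: quiver_def)
  show ?case
  proof (cases "?F = {}")
    case True
    then have "x \<in> int_points" by (auto simp: int_points_def)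
    then show ?thesis
      using less.prems of_int_floor_le le_of_int_ceiling by (intro bexI[of _ x]) auto
  next
    case False
    have F: "?F \<subseteq> arcs Q" using less.prems by (auto simp: weight_space_iff)
    have two: "\<exists>b'\<in>?F. b' \<noteq> b \<and> (v = head Q b' \<or> v = tail Q b')"
      if b: "b \<in> ?F" "v = head Q b \<or> v = tail Q b" for v b
    proof (rule ccontr)
      assume no: "\<not> ?thesis"
      have bQ: "b \<in> arcs Q" using F b by auto
      then have "v \<in> verts Q" using b by auto
      then have net: "net_flow Q v x \<in> \<int>" using less.prems by (auto simp: weight_space_iff)
      have int_in: "x $ a \<in> \<int>" if "a \<in> in_arcs Q v - {b}" for a
        using no that by auto
      have int_out: "x $ a \<in> \<int>" if "a \<in> out_arcs Q v - {b}" for a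
        using no that by auto
      have loop: "head Q b \<noteq> tail Q b" using bQ no_loops by metis
      have "x $ b \<in> \<int>"
      proof (cases "v = head Q b")
        case True
        have "(\<Sum>a\<in>in_arcs Q v. x $ a) = x $ b + (\<Sum>a\<in>in_arcs Q v - {b}. x $ a)"
          by (rule sum.remove) (use True bQ in auto)
        then have "x $ b = net_flow Q v x + (\<Sum>a\<in>out_arcs Q v. x $ a) - (\<Sum>a\<in>in_arcs Q v - {b}. x $ a)"
          by (simp add: net_flow_def)
        also have "\<dots> \<in> \<int>"
        proof (intro Ints_diff Ints_add net Ints_sum)
          fix a assume "a \<in> out_arcs Q v"
          then show "x $ a \<in> \<int>" using int_out[of a] True loop by (cases "a = b") auto
        qed (rule int_in)
        finally show ?thesis .
      next
        case False
        then have v: "v = tail Q b" using b by simp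
        have "(\<Sum>a\<in>out_arcs Q v. x $ a) = x $ b + (\<Sum>a\<in>out_arcs Q v - {b}. x $ a)"
          by (rule sum.remove) (use v bQ in auto)
        then have "x $ b = (\<Sum>a\<in>in_arcs Q v. x $ a) - (\<Sum>a\<in>out_arcs Q v - {b}. x $ a) - net_flow Q v x"
          by (simp add: net_flow_def)
        also have "\<dots> \<in> \<int>"
        proof (intro Ints_diff Ints_add net Ints_sum)
          fix a assume "a \<in> in_arcs Q v"
          then show "x $ a \<in> \<int>" using int_in[of a] v loop by (cases "a = b") auto
        qed (rule int_out)
        finally show ?thesis .
      qed
      then show False using b by simp
    qed
    obtain y :: "real ^ 'e" where y: "y \<noteq> 0" "\<And>a. a \<notin> ?F \<Longrightarrow> y $ a = 0" "\<And>v. net_flow Q v y = 0"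
      using nonzero_circulation[OF Q F False two] by blast
    define A where "A = {a. y $ a \<noteq> 0}"
    have A: "A \<noteq> {}" "A \<subseteq> ?F" using y(1,2) by (auto simp: A_def vec_eq_iff)
    \<comment> \<open>The time at which coordinate a of x + t y first becomes an integer.\<close>
    define hit where "hit a = (if 0 < y $ a then of_int \<lceil>x $ a\<rceil> - x $ a else of_int \<lfloor>x $ a\<rfloor> - x $ a) / y $ a" for a
    define t where "t = Min (hit ` A)"
    have hit_pos: "0 < hit a" if "a \<in> A" for a
    proof -
      have "x $ a \<notin> \<int>" "y $ a \<noteq> 0" using that A by (auto simp: A_def)
      then show ?thesis using Ints_strictly_between[of "x $ a"]
        by (auto simp: hit_def intro!: divide_pos_pos divide_neg_neg)
    qed
    have "t \<in> hit ` A" unfolding t_def using A by (intro Min_in) auto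
    then obtain b where b: "b \<in> A" "t = hit b" by auto
    have t_le: "t \<le> hit a" if "a \<in> A" for a unfolding t_def using that by simp
    have t_pos: "0 < t" using b hit_pos by simp
    let ?x = "x + t *\<^sub>R y"
    have between: "of_int \<lfloor>x $ a\<rfloor> \<le> ?x $ a \<and> ?x $ a \<le> of_int \<lceil>x $ a\<rceil>" for a
    proof (cases "0 < y $ a")
      case True
      then have "t \<le> (of_int \<lceil>x $ a\<rceil> - x $ a) / y $ a" using t_le[of a] by (simp add: A_def hit_def)
      then have "t * y $ a \<le> of_int \<lceil>x $ a\<rceil> - x $ a" using True by (simp add: pos_le_divide_eq)
      moreover have "0 \<le> t * y $ a" using True t_pos by simp
      ultimately show ?thesis using of_int_floor_le[of "x $ a"]
          unfolding vector_add_component vector_scaleR_component real_scaleR_def by linarith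
    next
      case nonpos: False
      show ?thesis
      proof (cases "y $ a = 0")
        case True
        then show ?thesis using of_int_floor_le[of "x $ a"] le_of_int_ceiling[of "x $ a"]
          by (simp only: vector_add_component vector_scaleR_component real_scaleR_def) simp
      next
        case False
        then have neg: "y $ a < 0" using nonpos by simp
        then have "t \<le> (of_int \<lfloor>x $ a\<rfloor> - x $ a) / y $ a" using t_le[of a] by (simp add: A_def hit_def)
        then have "of_int \<lfloor>x $ a\<rfloor> - x $ a \<le> t * y $ a" using neg by (simp add: neg_le_divide_eq)
        moreover have "t * y $ a \<le> 0" using neg t_pos by (simp add: mult_nonneg_nonpos)
        ultimately show ?thesis using le_of_int_ceiling[of "x $ a"]
          unfolding vector_add_component vector_scaleR_component real_scaleR_def by linarith
      qed
    qed
    have "?x $ b = (if 0 < y $ b then of_int \<lceil>x $ b\<rceil> else of_int \<lfloor>x $ b\<rfloor>)"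
      using b by (simp add: hit_def A_def)
    then have b_int: "?x $ b \<in> \<int>" by auto
    have "{a. ?x $ a \<notin> \<int>} \<subset> ?F"
    proof
      show "{a. ?x $ a \<notin> \<int>} \<subseteq> ?F" using y(2) by fastforce
      show "{a. ?x $ a \<notin> \<int>} \<noteq> ?F" using b b_int A by blast
    qed
    then have "card {a. ?x $ a \<notin> \<int>} < card ?F" by (intro psubset_card_mono) auto
    moreover have "?x \<in> weight_space Q \<theta>"
      using less.prems y(2,3) F by (auto simp: weight_space_iff net_flow_add net_flow_scale)
    ultimately obtain w where w: "w \<in> weight_space Q \<theta> \<inter> int_points"
      "\<And>a. of_int \<lfloor>?x $ a\<rfloor> \<le> w $ a \<and> w $ a \<le> of_int \<lceil>?x $ a\<rceil>"
      using less.hyps by blast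
    have "of_int \<lfloor>x $ a\<rfloor> \<le> w $ a \<and> w $ a \<le> of_int \<lceil>x $ a\<rceil>" for a
    proof -
      have "\<lfloor>x $ a\<rfloor> \<le> \<lfloor>?x $ a\<rfloor>" "\<lceil>?x $ a\<rceil> \<le> \<lceil>x $ a\<rceil>"
        using between[of a] by (simp_all only: le_floor_iff ceiling_le_iff)
      then have "(of_int \<lfloor>x $ a\<rfloor> :: real) \<le> of_int \<lfloor>?x $ a\<rfloor>" "(of_int \<lceil>?x $ a\<rceil> :: real) \<le> of_int \<lceil>x $ a\<rceil>"
        by (simp_all only: of_int_le_iff)
      then show ?thesis using w(2)[of a] by linarith
    qed
    then show ?thesis using w(1) by blast
  qed
qed

text \<open>One summand is a rounding of \<open>y\<close> divided by the number of summands; since the bounds are integral,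
they survive the rounding, both for this summand and for the rest.\<close>

lemma flow_decomposition:
  fixes Q :: "('v, 'e::finite) pre_digraph"
  assumes Q: "quiver Q"
    and "y \<in> weight_space Q (\<lambda>v. int D * \<theta> v)" "y \<in> int_points"
    and "\<And>a. of_nat D * of_int (lo a) \<le> y $ a" "\<And>a. y $ a \<le> of_nat D * of_int (hi a)"
  shows "\<exists>ws. length ws = D \<and> sum_list ws = y \<and>
    (\<forall>w\<in>set ws. w \<in> weight_space Q \<theta> \<and> w \<in> int_points \<and>
       (\<forall>a. of_int (lo a) \<le> w $ a \<and> w $ a \<le> of_int (hi a)))"
  using assms(2-)
proof (induction D arbitrary: y)
  case 0
  have "y $ a = 0" for a using "0.prems"(3,4)[of a] by simp
  then have "y = 0" by (simp add: vec_eq_iff)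
  then show ?case by simp
next
  case (Suc D)
  let ?N = "real (Suc D)"
  let ?x = "(1 / ?N) *\<^sub>R y"
  have "?x \<in> weight_space Q \<theta>"
    using Suc.prems(1) by (auto simp: weight_space_iff net_flow_scale divide_simps simp del: of_nat_Suc)
  then obtain w where w: "w \<in> weight_space Q \<theta>" "w \<in> int_points"
    "\<And>a. of_int \<lfloor>?x $ a\<rfloor> \<le> w $ a \<and> w $ a \<le> of_int \<lceil>?x $ a\<rceil>"
    using integral_flow_rounding[OF Q] by blast
  have round: "of_int i \<le> w $ a" if "of_int i \<le> y $ a / ?N" for i a
  proof -
    have "i \<le> \<lfloor>?x $ a\<rfloor>" using that by (simp add: le_floor_iff)
    then have "(of_int i :: real) \<le> of_int \<lfloor>?x $ a\<rfloor>" by (simp only: of_int_le_iff)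
    then show ?thesis using w(3)[of a] by linarith
  qed
  have round': "w $ a \<le> of_int i" if "y $ a / ?N \<le> of_int i" for i a
  proof -
    have "\<lceil>?x $ a\<rceil> \<le> i" using that by (simp add: ceiling_le_iff)
    then have "of_int \<lceil>?x $ a\<rceil> \<le> (of_int i :: real)" by (simp only: of_int_le_iff)
    then show ?thesis using w(3)[of a] by linarith
  qed
  have w_box: "of_int (lo a) \<le> w $ a \<and> w $ a \<le> of_int (hi a)" for a
    using Suc.prems(3,4)[of a]
    by (intro conjI round round') (simp_all add: field_simps del: of_nat_Suc)
  have rest: "real D * of_int (lo a) \<le> (y - w) $ a \<and> (y - w) $ a \<le> real D * of_int (hi a)" for a
  proof -
    obtain i where i: "y $ a = of_int i" using Suc.prems(2) by (auto simp: int_points_def elim: Ints_cases)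
    have "w $ a \<le> of_int (i - int D * lo a)"
    proof (rule round')
      have "real D * (?N * of_int (lo a)) \<le> real D * of_int i"
        using Suc.prems(3)[of a] i by (intro mult_left_mono) auto
      then show "y $ a / ?N \<le> of_int (i - int D * lo a)"
        using i by (simp add: field_simps)
    qed
    moreover have "of_int (i - int D * hi a) \<le> w $ a"
    proof (rule round)
      have "real D * of_int i \<le> real D * (?N * of_int (hi a))"
        using Suc.prems(4)[of a] i by (intro mult_left_mono) auto
      then show "of_int (i - int D * hi a) \<le> y $ a / ?N"
        using i by (simp add: field_simps)
    qed
    ultimately show ?thesis using i by simp
  qed
  have "y - w \<in> weight_space Q (\<lambda>v. int D * \<theta> v)"
    using Suc.prems(1) w(1) by (auto simp: weight_space_iff net_flow_diff algebra_simps)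
  moreover have "y - w \<in> int_points"
    using Suc.prems(2) w(2) by (auto simp: int_points_def)
  ultimately obtain ws where "length ws = D" "sum_list ws = y - w"
    "\<forall>w\<in>set ws. w \<in> weight_space Q \<theta> \<and> w \<in> int_points \<and>
       (\<forall>a. of_int (lo a) \<le> w $ a \<and> w $ a \<le> of_int (hi a))"
    using Suc.IH[of "y - w"] rest by blast
  then show ?case
    using w w_box by (intro exI[of _ "w # ws"]) auto
qed

section \<open>Integral affine dependences\<close>

text \<open>A rational-linear map that does not kill a given real number; additivity and compatibility with
integer factors are all that is used of it below.\<close>

lemma rational_linear_functional:
  fixes c :: real
  assumes "c \<noteq> 0"
  obtains \<phi> :: "real \<Rightarrow> rat" where "\<And>x y. \<phi> (x + y) = \<phi> x + \<phi> y"
    "\<And>x n. \<phi> (of_int n * x) = of_int n * \<phi> x" "\<phi> c \<noteq> 0"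
proof -
  interpret vector_space_pair "\<lambda>(q::rat) (x::real). of_rat q * x" "(*) :: rat \<Rightarrow> rat \<Rightarrow> rat"
    by unfold_locales (auto simp: algebra_simps of_rat_add of_rat_mult)
  have "vs1.independent {c}"
    using assms by (simp add: vs1.dependent_single)
  then obtain g where g: "Vector_Spaces.linear (\<lambda>(q::rat) (x::real). of_rat q * x) (*) g" "g c = 1"
    using linear_independent_extend[of "{c}" "\<lambda>_. 1"] by auto
  interpret g: Vector_Spaces.linear "\<lambda>(q::rat) (x::real). of_rat q * x" "(*)" g by fact
  have "g (of_int n * x) = of_int n * g x" for n x
    using g.scale[of "of_int n" x] by simp
  then show ?thesis using that[of g] g.add g(2) by simp
qed

lemma common_denominator:
  fixes E :: "'x \<Rightarrow> rat"
  assumes "finite T"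
  shows "\<exists>N::int. N > 0 \<and> (\<forall>z\<in>T. of_int N * E z \<in> \<int>)"
  using assms
proof (induction T)
  case (insert v T)
  then obtain N where N: "N > 0" "\<forall>z\<in>T. of_int N * E z \<in> \<int>" by auto
  obtain p q where pq: "E v = Fract p q" "q > 0" by (cases "E v") auto
  have "of_int (q * N) * E z \<in> \<int>" if "z \<in> T" for z
    using N(2) that Ints_mult[of "of_int q" "of_int N * E z"] by (auto simp: mult.assoc)
  moreover have "of_int (q * N) * E v = of_int (N * p)"
    using pq by (simp add: Fract_of_int_quotient)
  ultimately show ?case
    using N(1) pq(2) by (intro exI[of _ "q * N"]) (auto simp del: of_int_mult)
qed (auto intro: exI[of _ 1])

text \<open>A real dependence among integral points stays a dependence when a rational-linear functional with
rational values is applied to its coefficients. Choosing one that does not kill a given coefficient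
keeps the dependence nontrivial, and clearing denominators makes it integral.\<close>

lemma integral_affine_dependence:
  fixes T :: "(real ^ 'm) set"
  assumes "finite T" "T \<subseteq> int_points" "affine_dependent T"
  obtains e :: "real ^ 'm \<Rightarrow> int" where "sum e T = 0" "\<exists>z\<in>T. e z \<noteq> 0"
    "(\<Sum>z\<in>T. of_int (e z) *\<^sub>R z) = 0"
proof -
  obtain U z0 where U: "sum U T = 0" "z0 \<in> T" "U z0 \<noteq> 0" "(\<Sum>z\<in>T. U z *\<^sub>R z) = 0"
    using assms(3) unfolding affine_dependent_explicit_finite[OF assms(1)] by blast
  obtain \<phi> :: "real \<Rightarrow> rat" where \<phi>: "\<And>x y. \<phi> (x + y) = \<phi> x + \<phi> y"
    "\<And>x n. \<phi> (of_int n * x) = of_int n * \<phi> x" "\<phi> (U z0) \<noteq> 0"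
    using rational_linear_functional[OF U(3)] by blast
  have \<phi>0: "\<phi> 0 = 0" using \<phi>(1)[of 0 0] by simp
  have \<phi>_sum: "\<phi> (\<Sum>z\<in>T. h z) = (\<Sum>z\<in>T. \<phi> (h z))" for h
    using assms(1) by (induction T) (auto simp: \<phi>0 \<phi>(1))
  obtain N :: int where N: "N > 0" "\<forall>z\<in>T. of_int N * \<phi> (U z) \<in> \<int>"
    using common_denominator[OF assms(1), of "\<lambda>z. \<phi> (U z)"] by blast
  define e where "e z = \<lfloor>of_int N * \<phi> (U z)\<rfloor>" for z
  have e: "of_int (e z) = of_int N * \<phi> (U z)" if "z \<in> T" for z
    using N(2) that by (auto simp: e_def elim: Ints_cases)
  have "(of_int (sum e T) :: rat) = of_int N * (\<Sum>z\<in>T. \<phi> (U z))"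
    by (simp add: e sum_distrib_left)
  also have "(\<Sum>z\<in>T. \<phi> (U z)) = 0"
    using U(1) by (simp add: \<phi>_sum[symmetric] \<phi>0)
  finally have "sum e T = 0" by (simp only: mult_zero_right of_int_eq_0_iff)
  moreover have "\<exists>z\<in>T. e z \<noteq> 0"
    using e[OF U(2)] N(1) \<phi>(3) U(2) by (intro bexI[of _ z0]) auto
  moreover have "(\<Sum>z\<in>T. of_int (e z) * z $ i) = 0" for i
  proof -
    define k where "k z = \<lfloor>z $ i\<rfloor>" for z :: "real ^ 'm"
    have k: "z $ i = of_int (k z)" if "z \<in> T" for z
      using assms(2) that by (auto simp: int_points_def k_def elim!: Ints_cases dest!: subsetD spec[of _ i])
    have "(\<Sum>z\<in>T. of_int (k z) * U z) = (\<Sum>z\<in>T. U z *\<^sub>R z) $ i"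
      by (simp add: k mult.commute)
    then have zero: "(\<Sum>z\<in>T. of_int (k z) * \<phi> (U z)) = 0"
      using U(4) by (simp add: \<phi>_sum[symmetric] \<phi>(2)[symmetric] \<phi>0)
    have "(of_int (\<Sum>z\<in>T. e z * k z) :: rat) = of_int N * (\<Sum>z\<in>T. of_int (k z) * \<phi> (U z))"
      by (simp add: e sum_distrib_left mult_ac)
    then have "(\<Sum>z\<in>T. e z * k z) = 0" by (simp only: zero mult_zero_right of_int_eq_0_iff)
    then have "(of_int (\<Sum>z\<in>T. e z * k z) :: real) = 0" by (simp only: of_int_0)
    then show ?thesis by (simp add: k)
  qed
  ultimately show ?thesis using that by (auto simp: vec_eq_iff)
qed

text \<open>Each coordinate of an affine map is both convex and concave.\<close>

lemma affine_map_on_convex_combination: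
  fixes f :: "'a::real_vector \<Rightarrow> real ^ 'e::finite"
  assumes f: "affine_map_on A f" "affine A"
    and V: "finite V" "V \<subseteq> A" and s: "\<And>z. z \<in> V \<Longrightarrow> 0 \<le> s z" "sum s V = 1"
  shows "f (\<Sum>z\<in>V. s z *\<^sub>R z) = (\<Sum>z\<in>V. s z *\<^sub>R f z)"
proof -
  have "f (\<Sum>z\<in>V. s z *\<^sub>R z) $ a = (\<Sum>z\<in>V. s z * f z $ a)" for a
  proof -
    have eq: "f (p *\<^sub>R x + q *\<^sub>R y) $ a = p * f x $ a + q * f y $ a"
      if "x \<in> A" "y \<in> A" "p + q = 1" for x y p q
    proof -
      have "f ((1 - q) *\<^sub>R x + q *\<^sub>R y) = (1 - q) *\<^sub>R f x + q *\<^sub>R f y"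
        using f(1) that by (simp add: affine_map_on_def)
      moreover have "p = 1 - q" using that by simp
      ultimately show ?thesis by simp
    qed
    have conv: "convex_on A (\<lambda>x. f x $ a)" "convex_on A (\<lambda>x. - (f x $ a))"
      using f(2) by (auto simp: convex_on_def eq affine_imp_convex)
    have "V \<noteq> {}" using s(2) by auto
    then show ?thesis
      using convex_on_sum[OF V(1) _ conv(1) s(2), of "\<lambda>z. z"] convex_on_sum[OF V(1) _ conv(2) s(2), of "\<lambda>z. z"]
        s(1) V(2) by (fastforce simp: sum_negf)
  qed
  then show ?thesis by (simp add: vec_eq_iff)
qed

section \<open>The lattice points of a flow polytope\<close>

definition toric_relation :: "(real ^ 'm) set \<Rightarrow> (real ^ 'm) mono \<Rightarrow> (real ^ 'm) mono \<Rightarrow> bool" where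
  "toric_relation V \<alpha> \<beta> \<longleftrightarrow>
     (\<Sum>z\<in>V. of_nat (Poly_Mapping.lookup \<alpha> z) *\<^sub>R z) = (\<Sum>z\<in>V. of_nat (Poly_Mapping.lookup \<beta> z) *\<^sub>R z) \<and>
     (\<Sum>z\<in>V. Poly_Mapping.lookup \<alpha> z) = (\<Sum>z\<in>V. Poly_Mapping.lookup \<beta> z)"

lemma equivp_toric_relation: "equivp (toric_relation V)"
  by (rule equivpI) (auto simp: toric_relation_def reflp_def symp_def transp_def)

lemma toric_relation_add: "toric_relation V m n \<Longrightarrow> toric_relation V (m + k) (n + k)"
  by (simp add: toric_relation_def lookup_add sum.distrib scaleR_left_distrib)

lemma toric_ideal_eq:
  "toric_ideal P = genideal (mpoly_ring (P \<inter> int_points))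
    {monomial_poly \<alpha> - monomial_poly \<beta> |\<alpha> \<beta>. \<alpha> \<in> monomials (P \<inter> int_points) \<and>
       \<beta> \<in> monomials (P \<inter> int_points) \<and> toric_relation (P \<inter> int_points) \<alpha> \<beta>}"
  unfolding toric_ideal_def Let_def toric_relation_def ..

lemma net_flow_sum: "net_flow Q v (sum h A) = (\<Sum>i\<in>A. net_flow Q v (h i))"
  by (simp add: net_flow_eq_inner inner_sum_right)

text \<open>A polytope \<open>P\<close> with an equivalence \<open>f\<close> onto a flow region. The flows provide integral coordinates
for the lattice points of \<open>P\<close>.\<close>

locale flow_chart =
  fixes P :: "(real ^ 'm) set" and Q :: "('v, 'e::finite) pre_digraph"
    and \<theta> :: "'v \<Rightarrow> int" and l u :: "'e \<Rightarrow> nat" and f :: "real ^ 'm \<Rightarrow> real ^ 'e"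
  assumes quiver: "quiver Q"
    and affine_f: "affine_map_on (affine hull P) f"
    and bij_f: "bij_betw f (affine hull P) (affine hull (flow_region Q \<theta> l u))"
    and lattice_f: "f ` (affine hull P \<inter> int_points) = affine hull (flow_region Q \<theta> l u) \<inter> int_points"
    and image_f: "f ` P = flow_region Q \<theta> l u"
begin

definition V :: "(real ^ 'm) set" where "V = P \<inter> int_points"

definition coord :: "real ^ 'm \<Rightarrow> 'e \<Rightarrow> int" where "coord z a = \<lfloor>f z $ a\<rfloor>"

lemma V_hull: "V \<subseteq> affine hull P"
  using hull_subset[of P affine] by (auto simp: V_def)

lemma inj_f: "inj_on f (affine hull P)"
  using bij_f by (rule bij_betw_imp_inj_on)

lemma f_V: "f ` V = flow_region Q \<theta> l u \<inter> int_points"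
proof
  show "f ` V \<subseteq> flow_region Q \<theta> l u \<inter> int_points"
    using image_f lattice_f V_hull by (fastforce simp: V_def)
  show "flow_region Q \<theta> l u \<inter> int_points \<subseteq> f ` V"
  proof
    fix w assume w: "w \<in> flow_region Q \<theta> l u \<inter> int_points"
    then obtain p where p: "p \<in> P" "w = f p" using image_f by blast
    have "w \<in> affine hull (flow_region Q \<theta> l u) \<inter> int_points"
      using w by (simp add: hull_inc)
    then obtain q where q: "q \<in> affine hull P \<inter> int_points" "w = f q"
      using lattice_f by blast
    have "p = q" using inj_onD[OF inj_f] p q hull_inc[of p P affine] by auto
    then show "w \<in> f ` V" using p q by (auto simp: V_def)
  qed
qed

lemma f_eq_coord:
  assumes "z \<in> V"
  shows "f z $ a = of_int (coord z a)"
proof -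
  have "f z \<in> int_points" using f_V assms by blast
  then have "f z $ a \<in> \<int>" by (simp add: int_points_def)
  then show ?thesis by (auto simp: coord_def elim: Ints_cases)
qed

lemma f_bounds:
  assumes "z \<in> V"
  shows "a \<in> arcs Q \<Longrightarrow> int (l a) \<le> coord z a \<and> coord z a \<le> int (u a)"
    and "a \<notin> arcs Q \<Longrightarrow> coord z a = 0" and "f z \<in> weight_space Q \<theta>"
proof -
  have "f z \<in> flow_region Q \<theta> l u" using f_V assms by blast
  then have w: "f z \<in> weight_space Q \<theta>"
    and b: "\<And>a. a \<in> arcs Q \<Longrightarrow> of_nat (l a) \<le> f z $ a \<and> f z $ a \<le> of_nat (u a)"
    by (auto simp: flow_region_def)
  show "f z \<in> weight_space Q \<theta>" by (rule w)
  show "int (l a) \<le> coord z a \<and> coord z a \<le> int (u a)" if "a \<in> arcs Q"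
    using b[OF that] unfolding f_eq_coord[OF assms] by linarith
  show "coord z a = 0" if "a \<notin> arcs Q"
    using w that f_eq_coord[OF assms, of a] by (simp add: weight_space_iff)
qed

lemma inj_coord: "inj_on coord V"
proof (rule inj_onI)
  fix z z' assume z: "z \<in> V" "z' \<in> V" "coord z = coord z'"
  then have "f z = f z'" by (simp add: vec_eq_iff f_eq_coord)
  then show "z = z'" using inj_onD[OF inj_f] z V_hull by blast
qed

lemma finite_V: "finite V"
proof -
  have "coord ` V \<subseteq> PiE UNIV (\<lambda>a. {0..int (u a)})"
  proof
    fix h assume "h \<in> coord ` V"
    then obtain z where z: "z \<in> V" "h = coord z" by blast
    have "0 \<le> coord z a \<and> coord z a \<le> int (u a)" for a
      using f_bounds(1,2)[OF z(1), of a] by (cases "a \<in> arcs Q") auto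
    then show "h \<in> PiE UNIV (\<lambda>a. {0..int (u a)})" using z by auto
  qed
  moreover have "finite (PiE (UNIV :: 'e set) (\<lambda>a. {0..int (u a)}))"
    by (intro finite_PiE) auto
  ultimately show ?thesis
    using finite_imageD[OF _ inj_coord] finite_subset by blast
qed

sublocale lattice_configuration V coord
  using finite_V inj_coord by unfold_locales

text \<open>Divided by the common degree, both sides become points of the affine hull of \<open>P\<close>, where \<open>f\<close> is
injective and commutes with convex combinations.\<close>

lemma toric_relation_iff_same_fibre:
  assumes "m \<in> monomials V" "n \<in> monomials V"
  shows "toric_relation V m n \<longleftrightarrow> same_fibre m n"
proof -
  let ?N = "\<lambda>p. \<Sum>z\<in>V. Poly_Mapping.lookup p z"
  let ?P = "\<lambda>p. \<Sum>z\<in>V. of_nat (Poly_Mapping.lookup p z) *\<^sub>R z"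
  let ?F = "\<lambda>p. \<Sum>z\<in>V. of_nat (Poly_Mapping.lookup p z) *\<^sub>R f z"
  have N: "wdeg V (\<lambda>_. 1) p = int (?N p)" for p by (simp add: wdeg_def)
  have F: "?F p $ a = of_int (wdeg V (\<lambda>z. coord z a) p)" for p a
    by (simp add: wdeg_def f_eq_coord)
  have "?P m = ?P n \<longleftrightarrow> ?F m = ?F n" if eq: "?N m = ?N n"
  proof (cases "?N m = 0")
    case True
    then have "\<forall>z\<in>V. Poly_Mapping.lookup m z = 0" "\<forall>z\<in>V. Poly_Mapping.lookup n z = 0"
      using eq finite_V by (simp_all add: sum_nonneg_eq_0_iff)
    then show ?thesis by simp
  next
    case False
    define k where "k = real (?N m)"
    have k: "k > 0" using False unfolding k_def of_nat_0_less_iff by simp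
    have avg: "(1 / k) *\<^sub>R ?P p \<in> affine hull P \<and> f ((1 / k) *\<^sub>R ?P p) = (1 / k) *\<^sub>R ?F p"
      if "real (?N p) = k" for p
    proof -
      let ?s = "\<lambda>z. real (Poly_Mapping.lookup p z) / k"
      have s: "sum ?s V = 1" "\<And>z. z \<in> V \<Longrightarrow> 0 \<le> ?s z"
        using k that by (simp_all add: sum_divide_distrib[symmetric])
      have P: "(1 / k) *\<^sub>R ?P p = (\<Sum>z\<in>V. ?s z *\<^sub>R z)" and F: "(1 / k) *\<^sub>R ?F p = (\<Sum>z\<in>V. ?s z *\<^sub>R f z)"
        by (simp_all add: scaleR_sum_right)
      have "(\<Sum>z\<in>V. ?s z *\<^sub>R z) \<in> affine hull P"
        using finite_V s V_hull
        by (intro convex_sum affine_imp_convex affine_affine_hull) auto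
      then show ?thesis
        using affine_map_on_convex_combination[OF affine_f affine_affine_hull finite_V V_hull, of ?s] s
        unfolding P F by blast
    qed
    have avg_m: "(1 / k) *\<^sub>R ?P m \<in> affine hull P" "f ((1 / k) *\<^sub>R ?P m) = (1 / k) *\<^sub>R ?F m"
      using avg[of m] by (simp_all only: k_def)
    have avg_n: "(1 / k) *\<^sub>R ?P n \<in> affine hull P" "f ((1 / k) *\<^sub>R ?P n) = (1 / k) *\<^sub>R ?F n"
      using avg[of n] by (simp_all only: k_def eq)
    have "?P m = ?P n \<longleftrightarrow> (1 / k) *\<^sub>R ?P m = (1 / k) *\<^sub>R ?P n" using k by simp
    also have "\<dots> \<longleftrightarrow> f ((1 / k) *\<^sub>R ?P m) = f ((1 / k) *\<^sub>R ?P n)"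
      using inj_on_eq_iff[OF inj_f avg_m(1) avg_n(1)] by (rule sym)
    also have "\<dots> \<longleftrightarrow> ?F m = ?F n"
      unfolding avg_m(2) avg_n(2) using k by simp
    finally show ?thesis .
  qed
  moreover have "?F m = ?F n \<longleftrightarrow> (\<forall>a. wdeg V (\<lambda>z. coord z a) m = wdeg V (\<lambda>z. coord z a) n)"
    by (simp add: vec_eq_iff F del: sum_component)
  ultimately show ?thesis unfolding toric_relation_def same_fibre_def N of_nat_eq_iff by blast
qed

lemma monomial_of_flows:
  assumes "\<And>w. w \<in> set ws \<Longrightarrow> w \<in> flow_region Q \<theta> l u \<inter> int_points"
  shows "\<exists>\<beta>\<in>monomials V. wdeg V (\<lambda>_. 1) \<beta> = int (length ws) \<and>
    (\<forall>a. of_int (wdeg V (\<lambda>z. coord z a) \<beta>) = sum_list ws $ a) \<and>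
    f ` Poly_Mapping.keys \<beta> \<subseteq> set ws"
  using assms
proof (induction ws)
  case Nil
  then show ?case by (intro bexI[of _ 0]) (auto simp: zero_in_monomials)
next
  case (Cons w ws)
  then obtain \<beta> where \<beta>: "\<beta> \<in> monomials V" "wdeg V (\<lambda>_. 1) \<beta> = int (length ws)"
    "\<And>a. of_int (wdeg V (\<lambda>z. coord z a) \<beta>) = sum_list ws $ a" "f ` Poly_Mapping.keys \<beta> \<subseteq> set ws"
    by auto
  obtain z where z: "z \<in> V" "w = f z" using Cons.prems[of w] f_V by auto
  show ?case
    using z \<beta> by (intro bexI[of _ "\<beta> + Poly_Mapping.single z 1"])
      (auto simp: wdeg_add wdeg_single finite_V f_eq_coord keys_nat_add monomials_def)
qed

lemma box_decomposition:
  assumes \<alpha>: "(\<Sum>z\<in>V. \<alpha> z) = int D"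
    and lo: "\<And>a. \<exists>p\<in>V. coord p a \<le> lo a" "\<And>a. int D * lo a \<le> (\<Sum>z\<in>V. \<alpha> z * coord z a)"
    and hi: "\<And>a. \<exists>q\<in>V. hi a \<le> coord q a" "\<And>a. (\<Sum>z\<in>V. \<alpha> z * coord z a) \<le> int D * hi a"
  shows "\<exists>\<beta>\<in>monomials V. wdeg V (\<lambda>_. 1) \<beta> = int D \<and>
    (\<forall>a. wdeg V (\<lambda>z. coord z a) \<beta> = (\<Sum>z\<in>V. \<alpha> z * coord z a)) \<and>
    (\<forall>z\<in>Poly_Mapping.keys \<beta>. \<forall>a. lo a \<le> coord z a \<and> coord z a \<le> hi a)"
proof -
  define y where "y = (\<Sum>z\<in>V. of_int (\<alpha> z) *\<^sub>R f z)"
  have y: "y $ a = of_int (\<Sum>z\<in>V. \<alpha> z * coord z a)" for a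
    by (simp add: y_def f_eq_coord)
  have "net_flow Q v y = of_int (int D * \<theta> v)" if v: "v \<in> verts Q" for v
  proof -
    have "net_flow Q v y = (\<Sum>z\<in>V. of_int (\<alpha> z) * of_int (\<theta> v))"
      unfolding y_def net_flow_sum net_flow_scale
      using f_bounds(3) v by (intro sum.cong) (auto simp: weight_space_iff)
    also have "\<dots> = of_int ((\<Sum>z\<in>V. \<alpha> z) * \<theta> v)"
      by (simp add: sum_distrib_right)
    finally show ?thesis by (simp add: \<alpha>)
  qed
  moreover have "y $ a = 0" if "a \<notin> arcs Q" for a
    unfolding y using f_bounds(2) that by simp
  ultimately have "y \<in> weight_space Q (\<lambda>v. int D * \<theta> v)" by (simp add: weight_space_iff)
  moreover have "y \<in> int_points" by (auto simp: int_points_def y simp del: of_int_sum)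
  moreover have "real D * of_int (lo a) \<le> y $ a" for a
  proof -
    have "(of_int (int D * lo a) :: real) \<le> y $ a" unfolding y of_int_le_iff by (rule lo(2))
    then show ?thesis by simp
  qed
  moreover have "y $ a \<le> real D * of_int (hi a)" for a
  proof -
    have "y $ a \<le> of_int (int D * hi a)" unfolding y of_int_le_iff by (rule hi(2))
    then show ?thesis by simp
  qed
  ultimately obtain ws where ws: "length ws = D" "sum_list ws = y"
    "\<And>w. w \<in> set ws \<Longrightarrow> w \<in> weight_space Q \<theta> \<and> w \<in> int_points \<and>
       (\<forall>a. of_int (lo a) \<le> w $ a \<and> w $ a \<le> of_int (hi a))"
    using flow_decomposition[OF quiver, of y D \<theta> lo hi] by blast
  have "w \<in> flow_region Q \<theta> l u \<inter> int_points" if w: "w \<in> set ws" for w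
  proof -
    have "of_nat (l a) \<le> w $ a \<and> w $ a \<le> of_nat (u a)" if a: "a \<in> arcs Q" for a
    proof -
      obtain p q where pq: "p \<in> V" "coord p a \<le> lo a" "q \<in> V" "hi a \<le> coord q a"
        using lo(1) hi(1) by metis
      then have "int (l a) \<le> lo a" "hi a \<le> int (u a)"
        using f_bounds(1)[OF pq(1) a] f_bounds(1)[OF pq(3) a] by linarith+
      then have "(of_int (int (l a)) :: real) \<le> of_int (lo a)" "(of_int (hi a) :: real) \<le> of_int (int (u a))"
        by (simp_all only: of_int_le_iff)
      then show ?thesis using ws(3)[OF w] by (fastforce intro: order_trans)
    qed
    then show ?thesis using ws(3)[OF w] by (simp add: flow_region_def)
  qed
  then obtain \<beta> where \<beta>: "\<beta> \<in> monomials V" "wdeg V (\<lambda>_. 1) \<beta> = int D"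
    "\<And>a. of_int (wdeg V (\<lambda>z. coord z a) \<beta>) = y $ a" "f ` Poly_Mapping.keys \<beta> \<subseteq> set ws"
    using monomial_of_flows[of ws] ws(1,2) by blast
  have "wdeg V (\<lambda>z. coord z a) \<beta> = (\<Sum>z\<in>V. \<alpha> z * coord z a)" for a
    using \<beta>(3)[of a] unfolding y of_int_eq_iff .
  moreover have "lo a \<le> coord z a \<and> coord z a \<le> hi a" if "z \<in> Poly_Mapping.keys \<beta>" for z a
  proof -
    have "z \<in> V" using that \<beta>(1) by (auto simp: monomials_def)
    then show ?thesis
      using ws(3)[of "f z"] \<beta>(4) that f_eq_coord[of z a] by (metis image_subset_iff of_int_le_iff)
  qed
  ultimately show ?thesis using \<beta>(1,2) by blast
qed

text \<open>The positive and the negative part of an integral affine dependence are the exponent vectors of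
two monomials in the same fibre.\<close>

lemma dependent_monomials:
  assumes "aff_dim P = int d" and T: "T \<subseteq> V" "d + 2 \<le> card T"
  shows "\<exists>p\<in>monomials T. \<exists>q\<in>monomials T. same_fibre p q \<and> p \<noteq> 0 \<and>
    Poly_Mapping.keys p \<inter> Poly_Mapping.keys q = {}"
proof -
  have finT: "finite T" using T(1) finite_V finite_subset by blast
  have "aff_dim T \<le> int d"
    using aff_dim_subset[of T P] T(1) assms(1) by (auto simp: V_def)
  then have "affine_dependent T"
    using T(2) aff_dim_affine_independent[of T] by linarith
  then obtain e :: "real ^ 'm \<Rightarrow> int" where e: "sum e T = 0" "\<exists>z\<in>T. e z \<noteq> 0"
    "(\<Sum>z\<in>T. of_int (e z) *\<^sub>R z) = 0"
    using integral_affine_dependence[OF finT] T(1) by (auto simp: V_def)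
  define mon :: "(real ^ 'm \<Rightarrow> int) \<Rightarrow> (real ^ 'm) mono"
    where "mon h = (\<Sum>z\<in>T. Poly_Mapping.single z (nat (h z)))" for h
  have mon: "Poly_Mapping.lookup (mon h) z = (if z \<in> T then nat (h z) else 0)" for h z
    using finT by (simp add: mon_def lookup_sum lookup_single when_def)
  let ?p = "mon e" and ?q = "mon (\<lambda>z. - e z)"
  have pT: "?p \<in> monomials T" and qT: "?q \<in> monomials T"
    by (auto simp: monomials_def in_keys_iff mon split: if_splits)
  have disj: "Poly_Mapping.keys ?p \<inter> Poly_Mapping.keys ?q = {}"
    by (auto simp: in_keys_iff mon split: if_splits)
  have sums: "(\<Sum>z\<in>V. of_nat (Poly_Mapping.lookup (mon h) z) *\<^sub>R z) = (\<Sum>z\<in>T. real (nat (h z)) *\<^sub>R z)"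
    "(\<Sum>z\<in>V. Poly_Mapping.lookup (mon h) z) = (\<Sum>z\<in>T. nat (h z))" for h
    using T(1) finite_V by (auto intro!: sum.mono_neutral_cong_right simp: mon)
  have "(\<Sum>z\<in>T. real (nat (e z)) *\<^sub>R z) - (\<Sum>z\<in>T. real (nat (- e z)) *\<^sub>R z) = (\<Sum>z\<in>T. of_int (e z) *\<^sub>R z)"
    unfolding sum_subtractf[symmetric] scaleR_left_diff_distrib[symmetric]
    by (intro sum.cong refl arg_cong2[where f = scaleR]) auto
  moreover have "int (\<Sum>z\<in>T. nat (e z)) - int (\<Sum>z\<in>T. nat (- e z)) = sum e T"
    unfolding of_nat_sum sum_subtractf[symmetric] by (intro sum.cong) auto
  ultimately have "(\<Sum>z\<in>T. real (nat (e z)) *\<^sub>R z) = (\<Sum>z\<in>T. real (nat (- e z)) *\<^sub>R z)"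
    "int (\<Sum>z\<in>T. nat (e z)) = int (\<Sum>z\<in>T. nat (- e z))"
    using e(1,3) by simp_all
  then have "toric_relation V ?p ?q"
    unfolding toric_relation_def sums of_nat_eq_iff by blast
  moreover have "?p \<in> monomials V" "?q \<in> monomials V" using pT qT T(1) by (auto simp: monomials_def)
  ultimately have same: "same_fibre ?p ?q" using toric_relation_iff_same_fibre by blast
  have "?p \<noteq> 0"
  proof
    assume "?p = 0"
    then have "e z \<le> 0" if "z \<in> T" for z
      using mon[of e z] that by simp
    then have "\<forall>z\<in>T. - e z = 0"
      using e(1) finT sum_nonneg_eq_0_iff[of T "\<lambda>z. - e z"] by (simp add: sum_negf)
    then show False using e(2) by simp
  qed
  then show ?thesis using pT qT same disj by blast
qed

lemma box_decomposable: "aff_dim P = int d \<Longrightarrow> box_decomposable V coord d"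
  by unfold_locales (rule box_decomposition dependent_monomials; assumption)+

end

theorem proposition7p4:
  fixes P :: "(real ^ 'm) set" and Q :: "('v, 'e::finite) pre_digraph" and d :: nat
  assumes "flow_polytope_of Q P"
    and "aff_dim P = int d"
    and "d \<noteq> 1"
  shows "\<exists>r. monomial_order (P \<inter> int_points) r \<and>
    (\<exists>G \<subseteq> monomials (P \<inter> int_points).
       (\<forall>m\<in>G. squarefree_mono m \<and> mono_degree m \<le> d) \<and>
       initial_ideal (P \<inter> int_points) r (toric_ideal P :: (real ^ 'm, 'k::field) mpoly set) =
         genideal (mpoly_ring (P \<inter> int_points)) (monomial_poly ` G))"
proof -
  obtain \<theta> l u f where "flow_chart P Q \<theta> l u f"
    using assms(1) unfolding flow_polytope_of_def lattice_equivalent_def flow_chart_def by blast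
  then interpret flow_chart P Q \<theta> l u f .
  interpret box_decomposable V coord d by (rule box_decomposable[OF assms(2)])
  define G where "G = {m. nonminimal m \<and> squarefree_mono m \<and> mono_degree m \<le> d}"
  have G: "G \<subseteq> monomials V" by (auto simp: G_def nonminimal_def)
  have "initial_ideal V term_order (genideal (mpoly_ring V :: (real ^ 'm, 'k) mpoly ring)
      {monomial_poly \<alpha> - monomial_poly \<beta> |\<alpha> \<beta>. \<alpha> \<in> monomials V \<and> \<beta> \<in> monomials V \<and> toric_relation V \<alpha> \<beta>}) =
    genideal (mpoly_ring V) (monomial_poly ` G)"
  proof (rule initial_ideal_binomial_ideal[OF monomial_order_term_order equivp_toric_relation
        toric_relation_add G])
    fix g assume "g \<in> G"
    then obtain n where n: "g \<in> monomials V" "n \<in> monomials V" "same_fibre g n" "order_vector n < order_vector g"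
      by (auto simp: G_def nonminimal_def)
    then show "\<exists>n\<in>monomials V. toric_relation V g n \<and> n \<noteq> g \<and> (n, g) \<in> term_order"
      by (intro bexI[of _ n]) (auto simp: toric_relation_iff_same_fibre term_order_def)
  next
    fix m n assume mn: "m \<in> monomials V" "n \<in> monomials V" "toric_relation V m n" "n \<noteq> m" "(n, m) \<in> term_order"
    then have "order_vector n < order_vector m"
      using order_vector_inj[of n m] by (auto simp: term_order_def order_le_less)
    then have "nonminimal m"
      using mn by (auto simp: nonminimal_def toric_relation_iff_same_fibre)
    then obtain g k where gk: "minimal_generator g" "k \<in> monomials V" "m = g + k"
      by (rule minimal_generator_divides)
    then have "g \<in> G"
      using minimal_generator_bounds[OF gk(1) assms(3)] by (simp add: G_def minimal_generator_def)
    then show "\<exists>g\<in>G. \<exists>k\<in>monomials V. m = g + k" using gk by blast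
  qed
  then have "initial_ideal V term_order (toric_ideal P :: (real ^ 'm, 'k) mpoly set) =
      genideal (mpoly_ring V) (monomial_poly ` G)"
    by (simp add: toric_ideal_eq V_def)
  moreover have "\<forall>m\<in>G. squarefree_mono m \<and> mono_degree m \<le> d" by (simp add: G_def)
  ultimately show ?thesis
    using monomial_order_term_order G unfolding V_def by blast
qed

end
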